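(* Let $n\ge 2$, $\alpha\in(0,1)$, and let $\Omega^o,\Omega^i\subset\mathbb{R}^n$ be bounded open connected sets of class $C^{1,\alpha}$ with connected exteriors $\mathbb{R}^n\setminus\overline{\Omega^o}$, $\mathbb{R}^n\setminus\overline{\Omega^i}$ and with $\overline{\Omega^i}\subseteq\Omega^o$. Let $\phi_0=\mathrm{id}_{\partial\Omega^i}$, and let $\omega$, $\delta_{\Omega^i}$, $\tilde\delta\in(0,\delta_{\Omega^i})$, the sets $\Omega^i_{\omega,\delta}$ and the real analytic extension operator $\mathbf{E}$ (defined on a neighborhood $\tilde{\mathcal{W}}_0$ of $\phi_0$) be as in the context. Then there exist an open neighborhood $\mathcal{W}^\ast_0\subseteq\tilde{\mathcal{W}}_0$ of $\phi_0$ in $\mathcal{A}^{\Omega^o}_{\partial\Omega^i}$, positive numbers $0<\rho_1<\rho_2<\tilde\delta<\delta_{\Omega^i}$, and a real analytic map $\Psi$ from $\mathcal{W}^\ast_0$ to $C^{1,\alpha}(\overline{\Omega^o},\mathbb{R}^n)$, $\phi\mapsto\Psi[\phi]$, such that: (i) $\Psi[\phi]$ is a $C^{1,\alpha}$-diffeomorphism of $\overline{\Omega^o}$ onto itself, for all $\phi\in\mathcal{W}^\ast_0$; (ii) $\Psi[\phi]=\mathbf{E}[\phi]$ on $\overline{\Omega^i_{\omega,\rho_1}}$ and $\Psi[\phi]=\mathrm{id}_{\overline{\Omega^o}}$ on $\overline{\Omega^o}\setminus\Omega^i_{\omega,\rho_2}$, for all $\phi\in\mathcal{W}^\ast_0$;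 (iii) $\Psi[\phi](\Omega^i)=\Omega^i[\phi]$ and $\Psi[\phi](\Omega^o\setminus\overline{\Omega^i})=\Omega^o\setminus\overline{\Omega^i[\phi]}$, for all $\phi\in\mathcal{W}^\ast_0$.
   Context: Class of diffeomorphisms. $\mathcal{A}_{\partial\Omega^i}$ is the set of $\phi\in C^{1,\alpha}(\partial\Omega^i,\mathbb{R}^n)$ that are injective and whose differential $d\phi(y)$ is injective for all $y\in\partial\Omega^i$; it is open in $C^{1,\alpha}(\partial\Omega^i,\mathbb{R}^n)$. For $\phi\in\mathcal{A}_{\partial\Omega^i}$, $\mathbb{R}^n\setminus\phi(\partial\Omega^i)$ has exactly two open connected components (Jordan–Leray); the bounded one is denoted $\Omega^i[\phi]$. Set $\mathcal{A}^{\Omega^o}_{\partial\Omega^i}:=\{\phi\in\mathcal{A}_{\partial\Omega^i}:\overline{\Omega^i[\phi]}\subseteq\Omega^o\}$, with the topology of $C^{1,\alpha}(\partial\Omega^i,\mathbb{R}^n)$. Real analyticity is meant for maps between open subsets of Banach spaces. Tubular neighborhoods (known facts, fixed data). $\nu_{\Omega^i}$ is the outward unit normal to $\partial\Omega^i$. There are $\omega\in C^{1,\alpha}(\partial\Omega^i,\mathbb{R}^n)$ with $|\omega|=1$ and $\omega\cdot\nu_{\Omega^i}>\frac12$ on $\partial\Omega^i$, and $\delta_{\Omega^i}\in(0,\infty)$, such that for all $\delta\in(0,\delta_{\Omega^i})$ the sets $$\Omega^i_{\omega,\delta}:=\{x+s\omega(x):x\in\partial\Omega^i,\ s\in(-\delta,\delta)\},$$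 $$\Omega^{i,+}_{\omega,\delta}:=\{x+s\omega(x):x\in\partial\Omega^i,\ s\in(-\delta,0)\},\qquad \Omega^{i,-}_{\omega,\delta}:=\{x+s\omega(x):x\in\partial\Omega^i,\ s\in(0,\delta)\}$$ are open, connected and of class $C^{1,\alpha}$, with boundaries given by the points $x+s\omega(x)$, $x\in\partial\Omega^i$, with $s\in\{-\delta,\delta\}$, $s\in\{-\delta,0\}$, $s\in\{0,\delta\}$ respectively, and $\Omega^{i,+}_{\omega,\delta}\subseteq\Omega^i$, $\Omega^{i,-}_{\omega,\delta}\subseteq\mathbb{R}^n\setminus\overline{\Omega^i}$. For $\delta\in(0,\delta_{\Omega^i})$, $\mathcal{A}^\ast_{\overline{\Omega^i_{\omega,\delta}}}$ is the set of injective $\Phi\in C^{1,\alpha}(\overline{\Omega^i_{\omega,\delta}},\mathbb{R}^n)$ with $d\Phi(y)$ injective for all $y$ and $\Phi(\Omega^{i,+}_{\omega,\delta})\subseteq\Omega^i[\Phi_{|\partial\Omega^i}]$ (for such $\Phi$ one has $\Phi_{|\partial\Omega^i}\in\mathcal{A}_{\partial\Omega^i}$ and $\Phi(\Omega^{i,-}_{\omega,\delta})\subseteq\mathbb{R}^n\setminus\overline{\Omega^i[\Phi_{|\partial\Omega^i}]}$). The extension operator $\mathbf{E}$ (known to exist, and fixed). There are $\tilde\delta\in(0,\delta_{\Omega^i})$, an open neighborhood $\tilde{\mathcal{W}}_0$ of $\phi_0$ in $\mathcal{A}^{\Omega^o}_{\partial\Omega^i}$, and a real analytic map $\mathbf{E}$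 from $C^{1,\alpha}(\partial\Omega^i,\mathbb{R}^n)$ to $C^{1,\alpha}(\overline{\Omega^i_{\omega,\tilde\delta}},\mathbb{R}^n)$ which maps $\tilde{\mathcal{W}}_0$ into $\mathcal{A}^\ast_{\overline{\Omega^i_{\omega,\tilde\delta}}}$, such that $\mathbf{E}[\phi]_{|\partial\Omega^i}=\phi$ and $\mathbf{E}[\phi](\overline{\Omega^i_{\omega,\tilde\delta}})\subset\Omega^o$ for all $\phi\in\tilde{\mathcal{W}}_0$, and $\mathbf{E}[\phi_0]=\mathrm{id}_{\overline{\Omega^i_{\omega,\tilde\delta}}}$. *)

theory Defs
  imports "HOL-Analysis.Analysis" "HOL-Library.Function_Algebras" "HOL-Combinatorics.Permutations"
begin

section \<open>Spaces of functions as normed vector spaces\<close>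

text \<open>
  The Banach spaces occurring here depend on a set (a domain, or its boundary), so they cannot be
  types. Each is given by a carrier, a set of total functions vanishing off the set
  (so that equality in the space is equality of functions), and by a norm on that carrier.
\<close>

instantiation "fun" :: (type, real_vector) real_vector
begin

definition scaleR_fun :: "real \<Rightarrow> ('a \<Rightarrow> 'b) \<Rightarrow> 'a \<Rightarrow> 'b" where
  "scaleR_fun c f = (\<lambda>x. c *\<^sub>R f x)"

instance
  by standard (auto simp: scaleR_fun_def plus_fun_def fun_eq_iff algebra_simps)

end

definition restrict_zero :: "'a set \<Rightarrow> ('a \<Rightarrow> 'b::zero) \<Rightarrow> 'a \<Rightarrow> 'b" where
  "restrict_zero S f = (\<lambda>x. if x \<in> S then f x else 0)"

definition relatively_open :: "('v::real_vector \<Rightarrow> real) \<Rightarrow> 'v set \<Rightarrow> 'v set \<Rightarrow> bool" where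
  "relatively_open N A W \<longleftrightarrow>
     W \<subseteq> A \<and> (\<forall>u\<in>W. \<exists>\<epsilon>>0. \<forall>v\<in>A. N (v - u) < \<epsilon> \<longrightarrow> v \<in> W)"

definition symmetric_multilinear ::
  "nat \<Rightarrow> 'v::real_vector set \<Rightarrow> 'w::real_vector set \<Rightarrow> ((nat \<Rightarrow> 'v) \<Rightarrow> 'w) \<Rightarrow> bool" where
  "symmetric_multilinear k X Y A \<longleftrightarrow>
     (\<forall>h \<in> {..<k} \<rightarrow> X.
        A h \<in> Y \<and>
        (\<forall>g. (\<forall>i<k. g i = h i) \<longrightarrow> A g = A h) \<and>
        (\<forall>i<k. \<forall>u\<in>X. \<forall>v\<in>X. \<forall>a b.
           A (h(i := a *\<^sub>R u + b *\<^sub>R v)) = a *\<^sub>R A (h(i := u)) + b *\<^sub>R A (h(i := v))) \<and>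
        (\<forall>p. p permutes {..<k} \<longrightarrow> A (h \<circ> p) = A h))"

text \<open>
  Real analyticity of F from the open subset U of the normed space (X, NX) to (Y, NY): near each
  point u of U, F is the sum of a power series of bounded symmetric k-linear maps A k, where M k
  bounds the norm of A k and the sum of M k * r ^ k is finite. Openness of U is not part of the
  definition.
\<close>

definition real_analytic_map ::
  "'v::real_vector set \<Rightarrow> ('v \<Rightarrow> real) \<Rightarrow> 'w::real_vector set \<Rightarrow> ('w \<Rightarrow> real) \<Rightarrow>
   'v set \<Rightarrow> ('v \<Rightarrow> 'w) \<Rightarrow> bool" where
  "real_analytic_map X NX Y NY U F \<longleftrightarrow>
     U \<subseteq> X \<and> F ` U \<subseteq> Y \<and>
     (\<forall>u\<in>U. \<exists>r>0. \<exists>(A :: nat \<Rightarrow> (nat \<Rightarrow> 'v) \<Rightarrow> 'w) (M :: nat \<Rightarrow> real).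
        (\<forall>k. symmetric_multilinear k X Y (A k)) \<and>
        (\<forall>k. 0 \<le> M k \<and> (\<forall>h \<in> {..<k} \<rightarrow> X. NY (A k h) \<le> M k * (\<Prod>i<k. NX (h i)))) \<and>
        summable (\<lambda>k. M k * r ^ k) \<and>
        (\<forall>v\<in>U. NX (v - u) < r \<longrightarrow>
           (\<lambda>m. NY (F v - (\<Sum>k<m. A k (\<lambda>_. v - u)))) \<longlonglongrightarrow> 0))"


section \<open>The Schauder space on the closure of an open set\<close>

text \<open>
  f is of class C^{1,alpha} on the closure of the (bounded) open set U: f extends continuously to
  the closure and its differential on U extends to an alpha-Hoelder continuous function D on the
  closure. Boundedness is not required separately, as all sets U below are bounded.
\<close>

definition C1a_on ::
  "real \<Rightarrow> 'a::euclidean_space set \<Rightarrow> ('a \<Rightarrow> 'b::euclidean_space) \<Rightarrow> bool" where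
  "C1a_on \<alpha> U f \<longleftrightarrow>
     continuous_on (closure U) f \<and>
     (\<exists>D :: 'a \<Rightarrow> 'a \<Rightarrow>\<^sub>L 'b.
        (\<forall>x\<in>U. (f has_derivative blinfun_apply (D x)) (at x)) \<and>
        (\<exists>C. \<forall>x\<in>closure U. \<forall>y\<in>closure U. norm (D x - D y) \<le> C * dist x y powr \<alpha>))"

definition C1a_space ::
  "real \<Rightarrow> 'a::euclidean_space set \<Rightarrow> ('a \<Rightarrow> 'b::euclidean_space) set" where
  "C1a_space \<alpha> U = {f. C1a_on \<alpha> U f \<and> (\<forall>x. x \<notin> closure U \<longrightarrow> f x = 0)}"

text \<open>
  By continuity, the suprema over U agree with those over its closure.
\<close>

definition C1a_norm ::
  "real \<Rightarrow> 'a::euclidean_space set \<Rightarrow> ('a \<Rightarrow> 'b::euclidean_space) \<Rightarrow> real" where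
  "C1a_norm \<alpha> U f =
     (SUP x\<in>U. norm (f x)) +
     (SUP x\<in>U. onorm (frechet_derivative f (at x))) +
     (SUP (x, y)\<in>{(x, y). x \<in> U \<and> y \<in> U \<and> x \<noteq> y}.
        onorm (\<lambda>v. frechet_derivative f (at x) v - frechet_derivative f (at y) v)
          / dist x y powr \<alpha>)"

definition C1a_diffeo ::
  "real \<Rightarrow> 'a::euclidean_space set \<Rightarrow> 'a set \<Rightarrow> ('a \<Rightarrow> 'a) \<Rightarrow> bool" where
  "C1a_diffeo \<alpha> U V f \<longleftrightarrow>
     bij_betw f (closure U) (closure V) \<and> C1a_on \<alpha> U f \<and>
     C1a_on \<alpha> V (inv_into (closure U) f)"


section \<open>Sets of class C1a and function spaces on their boundary\<close>

text \<open>
  A local cylinder at the boundary point base, with unit axis e: points are split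
  orthogonally as base + z + t e with z orthogonal to e, and inside the cylinder
  norm z < radius, |t| < height the set is the strict hypograph t < graph z. A function of the
  n - 1 variables z is encoded as a function on the n-dimensional cylinder that does not depend
  on t; this changes neither its C^{1,alpha} regularity nor its norm.
\<close>

record 'a boundary_chart =
  base :: 'a
  axis :: 'a
  radius :: real
  height :: real
  graph :: "'a \<Rightarrow> real"

definition horizontal :: "'a::euclidean_space boundary_chart \<Rightarrow> 'a \<Rightarrow> 'a" where
  "horizontal c x = x - (x \<bullet> axis c) *\<^sub>R axis c"

definition cylinder :: "'a::euclidean_space boundary_chart \<Rightarrow> 'a set" where
  "cylinder c = {x. norm (horizontal c x) < radius c \<and> \<bar>x \<bullet> axis c\<bar> < height c}"

definition parametrization :: "'a::euclidean_space boundary_chart \<Rightarrow> 'a \<Rightarrow> 'a" where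
  "parametrization c x = base c + horizontal c x + graph c x *\<^sub>R axis c"

definition is_boundary_chart ::
  "real \<Rightarrow> 'a::euclidean_space set \<Rightarrow> 'a boundary_chart \<Rightarrow> bool" where
  "is_boundary_chart \<alpha> \<Omega> c \<longleftrightarrow>
     base c \<in> frontier \<Omega> \<and> norm (axis c) = 1 \<and> radius c > 0 \<and> height c > 0 \<and>
     (\<forall>x. graph c x = graph c (horizontal c x)) \<and>
     graph c 0 = 0 \<and> (\<forall>x\<in>cylinder c. \<bar>graph c x\<bar> < height c) \<and>
     C1a_on \<alpha> (cylinder c) (graph c) \<and>
     (\<forall>x\<in>cylinder c. base c + x \<in> \<Omega> \<longleftrightarrow> x \<bullet> axis c < graph c x)"

definition C1a_open_set :: "real \<Rightarrow> 'a::euclidean_space set \<Rightarrow> bool" where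
  "C1a_open_set \<alpha> \<Omega> \<longleftrightarrow>
     open \<Omega> \<and> (\<forall>p\<in>frontier \<Omega>. \<exists>c. is_boundary_chart \<alpha> \<Omega> c \<and> base c = p)"

definition C1a_boundary_space ::
  "real \<Rightarrow> 'a::euclidean_space set \<Rightarrow> ('a \<Rightarrow> 'b::euclidean_space) set" where
  "C1a_boundary_space \<alpha> \<Omega> =
     {\<phi>. (\<forall>c. is_boundary_chart \<alpha> \<Omega> c \<longrightarrow> C1a_on \<alpha> (cylinder c) (\<phi> \<circ> parametrization c)) \<and>
          (\<forall>x. x \<notin> frontier \<Omega> \<longrightarrow> \<phi> x = 0)}"

text \<open>
  As usual, the norm on the boundary space is defined through a fixed finite family of charts
  whose cylinders cover the (compact) boundary; different families give equivalent norms.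
\<close>

definition is_finite_atlas ::
  "real \<Rightarrow> 'a::euclidean_space set \<Rightarrow> 'a boundary_chart set \<Rightarrow> bool" where
  "is_finite_atlas \<alpha> \<Omega> \<C> \<longleftrightarrow>
     finite \<C> \<and> (\<forall>c\<in>\<C>. is_boundary_chart \<alpha> \<Omega> c) \<and>
     frontier \<Omega> \<subseteq> (\<Union>c\<in>\<C>. (+) (base c) ` cylinder c)"

definition C1a_boundary_norm ::
  "real \<Rightarrow> 'a::euclidean_space boundary_chart set \<Rightarrow> ('a \<Rightarrow> 'b::euclidean_space) \<Rightarrow> real" where
  "C1a_boundary_norm \<alpha> \<C> \<phi> = (\<Sum>c\<in>\<C>. C1a_norm \<alpha> (cylinder c) (\<phi> \<circ> parametrization c))"

definition is_outward_unit_normal :: "'a::euclidean_space set \<Rightarrow> 'a \<Rightarrow> 'a \<Rightarrow> bool" where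
  "is_outward_unit_normal \<Omega> y \<nu> \<longleftrightarrow>
     norm \<nu> = 1 \<and>
     ((\<lambda>x. ((x - y) \<bullet> \<nu>) / norm (x - y)) \<longlongrightarrow> 0) (at y within frontier \<Omega>) \<and>
     (\<exists>\<epsilon>>0. \<forall>t\<in>{0<..<\<epsilon>}. y - t *\<^sub>R \<nu> \<in> \<Omega> \<and> y + t *\<^sub>R \<nu> \<notin> closure \<Omega>)"

definition outward_normal :: "'a::euclidean_space set \<Rightarrow> 'a \<Rightarrow> 'a" where
  "outward_normal \<Omega> y = (THE \<nu>. is_outward_unit_normal \<Omega> y \<nu>)"

definition boundary_tangent_space :: "'a::euclidean_space set \<Rightarrow> 'a \<Rightarrow> 'a set" where
  "boundary_tangent_space \<Omega> y = {v. v \<bullet> outward_normal \<Omega> y = 0}"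


section \<open>Classes of diffeomorphisms\<close>

text \<open>
  The differential of a map on the boundary at y is a linear map on the tangent space; a derivative
  within the boundary (a linear map D on the whole space) is determined exactly on that subspace.
\<close>

definition boundary_diffeos ::
  "real \<Rightarrow> 'a::euclidean_space set \<Rightarrow> ('a \<Rightarrow> 'a) set" where
  "boundary_diffeos \<alpha> \<Omega> =
     {\<phi> \<in> C1a_boundary_space \<alpha> \<Omega>. inj_on \<phi> (frontier \<Omega>) \<and>
        (\<forall>y\<in>frontier \<Omega>. \<exists>D. (\<phi> has_derivative D) (at y within frontier \<Omega>) \<and>
           inj_on D (boundary_tangent_space \<Omega> y))}"

text \<open>
  The library's \<^const>\<open>inside\<close> is the union of the bounded components of the complement, i.e. the
  single bounded one when \<open>\<phi>\<close> is in the above class.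
\<close>

definition enclosed_domain :: "'a::euclidean_space set \<Rightarrow> ('a \<Rightarrow> 'a) \<Rightarrow> 'a set" where
  "enclosed_domain \<Omega> \<phi> = inside (\<phi> ` frontier \<Omega>)"

definition boundary_diffeos_in ::
  "real \<Rightarrow> 'a::euclidean_space set \<Rightarrow> 'a set \<Rightarrow> ('a \<Rightarrow> 'a) set" where
  "boundary_diffeos_in \<alpha> \<Omega>o \<Omega>i =
     {\<phi> \<in> boundary_diffeos \<alpha> \<Omega>i. closure (enclosed_domain \<Omega>i \<phi>) \<subseteq> \<Omega>o}"

definition layer ::
  "'a::euclidean_space set \<Rightarrow> ('a \<Rightarrow> 'a) \<Rightarrow> real set \<Rightarrow> 'a set" where
  "layer \<Omega> \<omega> J = {x + s *\<^sub>R \<omega> x | x s. x \<in> frontier \<Omega> \<and> s \<in> J}"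

abbreviation tube :: "'a::euclidean_space set \<Rightarrow> ('a \<Rightarrow> 'a) \<Rightarrow> real \<Rightarrow> 'a set" where
  "tube \<Omega> \<omega> \<delta> \<equiv> layer \<Omega> \<omega> {-\<delta><..<\<delta>}"

abbreviation inner_tube :: "'a::euclidean_space set \<Rightarrow> ('a \<Rightarrow> 'a) \<Rightarrow> real \<Rightarrow> 'a set" where
  "inner_tube \<Omega> \<omega> \<delta> \<equiv> layer \<Omega> \<omega> {-\<delta><..<0}"

abbreviation outer_tube :: "'a::euclidean_space set \<Rightarrow> ('a \<Rightarrow> 'a) \<Rightarrow> real \<Rightarrow> 'a set" where
  "outer_tube \<Omega> \<omega> \<delta> \<equiv> layer \<Omega> \<omega> {0<..<\<delta>}"

definition is_tubular_data ::
  "real \<Rightarrow> 'a::euclidean_space set \<Rightarrow> ('a \<Rightarrow> 'a) \<Rightarrow> real \<Rightarrow> bool" where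
  "is_tubular_data \<alpha> \<Omega> \<omega> \<delta>0 \<longleftrightarrow>
     \<omega> \<in> C1a_boundary_space \<alpha> \<Omega> \<and>
     (\<forall>x\<in>frontier \<Omega>. norm (\<omega> x) = 1 \<and> \<omega> x \<bullet> outward_normal \<Omega> x > 1/2) \<and>
     0 < \<delta>0 \<and>
     (\<forall>\<delta>\<in>{0<..<\<delta>0}.
        (\<forall>T\<in>{tube \<Omega> \<omega> \<delta>, inner_tube \<Omega> \<omega> \<delta>, outer_tube \<Omega> \<omega> \<delta>}.
           open T \<and> connected T \<and> C1a_open_set \<alpha> T) \<and>
        frontier (tube \<Omega> \<omega> \<delta>) = layer \<Omega> \<omega> {-\<delta>, \<delta>} \<and>
        frontier (inner_tube \<Omega> \<omega> \<delta>) = layer \<Omega> \<omega> {-\<delta>, 0} \<and>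
        frontier (outer_tube \<Omega> \<omega> \<delta>) = layer \<Omega> \<omega> {0, \<delta>} \<and>
        inner_tube \<Omega> \<omega> \<delta> \<subseteq> \<Omega> \<and>
        outer_tube \<Omega> \<omega> \<delta> \<subseteq> - closure \<Omega>)"

text \<open>
  At points of the frontier of the tube, the differential is the derivative within the closure,
  which is unique and equals the continuous extension of the differential from the interior since
  the tube is of class C^{1,alpha}.
\<close>

definition tube_diffeos ::
  "real \<Rightarrow> 'a::euclidean_space set \<Rightarrow> ('a \<Rightarrow> 'a) \<Rightarrow> real \<Rightarrow> ('a \<Rightarrow> 'a) set" where
  "tube_diffeos \<alpha> \<Omega> \<omega> \<delta> =
     {\<Phi> \<in> C1a_space \<alpha> (tube \<Omega> \<omega> \<delta>).
        inj_on \<Phi> (closure (tube \<Omega> \<omega> \<delta>)) \<and>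
        (\<forall>y\<in>closure (tube \<Omega> \<omega> \<delta>).
           \<exists>D. (\<Phi> has_derivative D) (at y within closure (tube \<Omega> \<omega> \<delta>)) \<and> inj D) \<and>
        \<Phi> ` inner_tube \<Omega> \<omega> \<delta> \<subseteq> enclosed_domain \<Omega> \<Phi>}"

end

theory Submission
  imports Defs
begin

text \<open>
  Fix a cutoff function \<open>\<eta>\<close> that is \<open>1\<close> on the tube of half-width \<open>\<delta>t / 4\<close> and \<open>0\<close> off the one of
  half-width \<open>\<delta>t / 2\<close>, and put
    \<open>\<Psi> \<phi> = id + \<eta> (E \<phi> - E \<phi>0)\<close>.
  Since \<open>E \<phi>0\<close> is the identity on the tube, this is \<open>E \<phi>\<close> where \<open>\<eta> = 1\<close> and the identity where
  \<open>\<eta> = 0\<close>, so it interpolates between the two as required.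

  Analyticity: multiplication by \<open>\<eta>\<close> is a bounded linear map from the Schauder space of the tube to
  that of \<open>\<Omega>o\<close> (\<open>cutoff_multiplication_bound\<close>), hence \<open>\<Psi>\<close> is \<open>E\<close> followed by a continuous affine
  map, which may be applied term by term to the power series of \<open>E\<close>
  (\<open>real_analytic_map_affine_comp\<close>).

  Bijectivity: by continuity of \<open>E\<close>, the perturbation \<open>g = \<eta> (E \<phi> - E \<phi>0)\<close> has differential of norm at
  most \<open>1/2\<close> once \<open>\<phi>\<close> is close to \<open>\<phi>0\<close>. Extended by zero it is defined on the whole space, which is
  convex, so \<open>g\<close> is a contraction and \<open>id + g\<close> is a global homeomorphism. It fixes every point off
  a compact subset of \<open>\<Omega>o\<close>, and a bijection that fixes the points off a subset of \<open>\<Omega>o\<close> maps \<open>\<Omega>o\<close>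
  onto itself. The differential of the inverse is Hoelder continuous because matrix inversion is
  Lipschitz on the set of matrices in question (\<open>C1a_diffeo_id_plus\<close>).

  Enclosed domains: a homeomorphism \<open>F\<close> of the whole space carries \<open>\<Omega>i\<close>, the inside of its frontier, to
  the inside of the image of the frontier (\<open>inside_homeomorphic_image_frontier\<close>), and on that
  frontier \<open>F\<close> is \<open>\<phi>\<close>.
\<close>

section \<open>The Schauder norm as a seminorm\<close>

abbreviation fderiv :: "('a::real_normed_vector \<Rightarrow> 'b::real_normed_vector) \<Rightarrow> 'a \<Rightarrow> 'a \<Rightarrow> 'b" where
  "fderiv f x \<equiv> frechet_derivative f (at x)"

text \<open>
  The triangle inequality has to be proved for each of the three suprema separately, hence the
  norm is split into them.
\<close>

definition sup_part :: "'a::euclidean_space set \<Rightarrow> ('a \<Rightarrow> 'b::euclidean_space) \<Rightarrow> real" where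
  "sup_part U f = (SUP x\<in>U. norm (f x))"

definition deriv_part :: "'a::euclidean_space set \<Rightarrow> ('a \<Rightarrow> 'b::euclidean_space) \<Rightarrow> real" where
  "deriv_part U f = (SUP x\<in>U. onorm (fderiv f x))"

definition hoelder_part ::
  "real \<Rightarrow> 'a::euclidean_space set \<Rightarrow> ('a \<Rightarrow> 'b::euclidean_space) \<Rightarrow> real" where
  "hoelder_part \<alpha> U f =
     (SUP (x, y)\<in>{(x, y). x \<in> U \<and> y \<in> U \<and> x \<noteq> y}.
        onorm (\<lambda>v. fderiv f x v - fderiv f y v) / dist x y powr \<alpha>)"

lemma C1a_norm_parts:
  "C1a_norm \<alpha> U f = sup_part U f + deriv_part U f + hoelder_part \<alpha> U f"
  by (simp add: C1a_norm_def sup_part_def deriv_part_def hoelder_part_def)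

lemma C1a_onI:
  fixes f :: "'a::euclidean_space \<Rightarrow> 'b::euclidean_space"
  assumes "continuous_on (closure U) f"
    and "\<And>x. x \<in> U \<Longrightarrow> (f has_derivative f' x) (at x)"
    and bl: "\<And>x. bounded_linear (f' x)"
    and C: "\<And>x y v. norm (f' x v - f' y v) \<le> C * dist x y powr \<alpha> * norm v"
  shows "C1a_on \<alpha> U f"
  unfolding C1a_on_def
proof (intro conjI exI[of _ "\<lambda>x. Blinfun (f' x)"] ballI exI[of _ "max C 0"])
  fix x y :: 'a
  have "norm (f' x v - f' y v) \<le> max C 0 * dist x y powr \<alpha> * norm v" for v
    by (rule order.trans[OF C]) (intro mult_right_mono, auto)
  then show "norm (Blinfun (f' x) - Blinfun (f' y)) \<le> max C 0 * dist x y powr \<alpha>"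
    by (intro norm_blinfun_bound)
      (auto simp: blinfun.diff_left bounded_linear_Blinfun_apply[OF bl])
qed (use assms in \<open>auto simp: bounded_linear_Blinfun_apply[OF bl]\<close>)

lemma C1a_on_has_fderiv:
  assumes "C1a_on \<alpha> U f" "x \<in> U"
  shows "(f has_derivative fderiv f x) (at x)"
  using assms unfolding C1a_on_def by (metis frechet_derivative_at)

lemma C1a_on_cong:
  assumes "open U" "C1a_on \<alpha> U f" and eq: "\<And>x. x \<in> closure U \<Longrightarrow> g x = f x"
  shows "C1a_on \<alpha> U g"
proof -
  obtain D C where D: "\<And>x. x \<in> U \<Longrightarrow> (f has_derivative blinfun_apply (D x)) (at x)"
    and C: "\<forall>x\<in>closure U. \<forall>y\<in>closure U. norm (D x - D y) \<le> C * dist x y powr \<alpha>"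
    and cf: "continuous_on (closure U) f"
    using assms(2) unfolding C1a_on_def by blast
  have "(g has_derivative blinfun_apply (D x)) (at x)" if "x \<in> U" for x
    using has_derivative_transform_within_open[OF D[OF that] \<open>open U\<close> that] eq closure_subset
    by (metis subsetD)
  moreover have "continuous_on (closure U) g"
    using cf eq by (simp cong: continuous_on_cong)
  ultimately show ?thesis
    unfolding C1a_on_def using C by blast
qed

lemma C1a_on_add:
  assumes "0 \<le> \<alpha>" "C1a_on \<alpha> U f" "C1a_on \<alpha> U g"
  shows "C1a_on \<alpha> U (f + g)"
proof -
  obtain D C where D: "\<And>x. x \<in> U \<Longrightarrow> (f has_derivative blinfun_apply (D x)) (at x)"
    and C: "\<And>x y. x\<in>closure U \<Longrightarrow> y\<in>closure U \<Longrightarrow> norm (D x - D y) \<le> C * dist x y powr \<alpha>"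
    and cf: "continuous_on (closure U) f"
    using assms(2) unfolding C1a_on_def by blast
  obtain D' C' where D': "\<And>x. x \<in> U \<Longrightarrow> (g has_derivative blinfun_apply (D' x)) (at x)"
    and C': "\<And>x y. x\<in>closure U \<Longrightarrow> y\<in>closure U \<Longrightarrow> norm (D' x - D' y) \<le> C' * dist x y powr \<alpha>"
    and cg: "continuous_on (closure U) g"
    using assms(3) unfolding C1a_on_def by blast
  show ?thesis
    unfolding C1a_on_def plus_fun_def
  proof (intro conjI exI[of _ "\<lambda>x. D x + D' x"] exI[of _ "C + C'"] ballI continuous_on_add cf cg)
    fix x y assume xy: "x \<in> closure U" "y \<in> closure U"
    have "norm (D x + D' x - (D y + D' y)) \<le> norm (D x - D y) + norm (D' x - D' y)"
      by (rule norm_diff_triangle_ineq)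
    then show "norm (D x + D' x - (D y + D' y)) \<le> (C + C') * dist x y powr \<alpha>"
      using C[OF xy] C'[OF xy] by (simp add: algebra_simps)
  next
    fix x assume "x \<in> U"
    have "blinfun_apply (D x + D' x) = (\<lambda>v. D x v + D' x v)"
      by (auto simp: blinfun.add_left)
    then show "((\<lambda>x. f x + g x) has_derivative blinfun_apply (D x + D' x)) (at x)"
      using has_derivative_add[OF D[OF \<open>x \<in> U\<close>] D'[OF \<open>x \<in> U\<close>]] by simp
  qed
qed

lemma C1a_on_scaleR:
  assumes "C1a_on \<alpha> U f"
  shows "C1a_on \<alpha> U (c *\<^sub>R f)"
proof -
  obtain D C where D: "\<And>x. x \<in> U \<Longrightarrow> (f has_derivative blinfun_apply (D x)) (at x)"
    and C: "\<And>x y. x\<in>closure U \<Longrightarrow> y\<in>closure U \<Longrightarrow> norm (D x - D y) \<le> C * dist x y powr \<alpha>"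
    and cf: "continuous_on (closure U) f"
    using assms(1) unfolding C1a_on_def by blast
  show ?thesis
    unfolding C1a_on_def scaleR_fun_def
  proof (intro conjI exI[of _ "\<lambda>x. c *\<^sub>R D x"] exI[of _ "\<bar>c\<bar> * C"] ballI
      continuous_on_scaleR continuous_on_const cf)
    fix x y assume xy: "x \<in> closure U" "y \<in> closure U"
    show "norm (c *\<^sub>R D x - c *\<^sub>R D y) \<le> \<bar>c\<bar> * C * dist x y powr \<alpha>"
      using mult_left_mono[OF C[OF xy], of "\<bar>c\<bar>"]
      by (simp flip: scaleR_diff_right add: mult.assoc)
  next
    fix x assume "x \<in> U"
    have "blinfun_apply (c *\<^sub>R D x) = (\<lambda>v. c *\<^sub>R D x v)"
      by (auto simp: blinfun.scaleR_left)
    then show "((\<lambda>x. c *\<^sub>R f x) has_derivative blinfun_apply (c *\<^sub>R D x)) (at x)"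
      using has_derivative_scaleR_right[OF D[OF \<open>x \<in> U\<close>], of c] by simp
  qed
qed

text \<open>
  The suprema in the norm are taken in the reals, so they carry information only because the
  quantities are bounded; this is where boundedness of \<open>U\<close> enters.
\<close>

lemma C1a_on_bdd_above:
  fixes f :: "'a::euclidean_space \<Rightarrow> 'b::euclidean_space"
  assumes bU: "bounded U" and \<alpha>: "0 \<le> \<alpha>" and f: "C1a_on \<alpha> U f"
  shows "bdd_above ((\<lambda>x. norm (f x)) ` U)"
    and "bdd_above ((\<lambda>x. onorm (fderiv f x)) ` U)"
    and "bdd_above ((\<lambda>(x, y). onorm (\<lambda>v. fderiv f x v - fderiv f y v) / dist x y powr \<alpha>) `
          {(x, y). x \<in> U \<and> y \<in> U \<and> x \<noteq> y})"
proof -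
  obtain D C where D: "\<And>x. x \<in> U \<Longrightarrow> (f has_derivative blinfun_apply (D x)) (at x)"
    and C: "\<And>x y. x\<in>closure U \<Longrightarrow> y\<in>closure U \<Longrightarrow> norm (D x - D y) \<le> C * dist x y powr \<alpha>"
    and cf: "continuous_on (closure U) f"
    using f unfolding C1a_on_def by blast
  have fd: "fderiv f x = blinfun_apply (D x)" if "x \<in> U" for x
    using frechet_derivative_at[OF D[OF that]] by simp
  have "compact (f ` closure U)"
    using cf bU by (simp add: compact_continuous_image)
  then have "bounded (f ` closure U)"
    by (rule compact_imp_bounded)
  then obtain B where "\<forall>x\<in>closure U. norm (f x) \<le> B"
    by (auto simp: bounded_iff)
  then show "bdd_above ((\<lambda>x. norm (f x)) ` U)"
    using closure_subset by (intro bdd_aboveI2[of _ _ B]) auto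
  show "bdd_above ((\<lambda>x. onorm (fderiv f x)) ` U)"
  proof (cases "U = {}")
    case False
    then obtain z where z: "z \<in> U" by blast
    obtain d where d: "\<And>x. x \<in> U \<Longrightarrow> dist x z \<le> d"
      using bU by (metis bounded_any_center dist_commute)
    have "onorm (fderiv f x) \<le> norm (D z) + \<bar>C\<bar> * d powr \<alpha>" if x: "x \<in> U" for x
    proof -
      have xz: "x \<in> closure U" "z \<in> closure U"
        using x z closure_subset by auto
      have "onorm (fderiv f x) = norm (D x)"
        by (simp add: fd[OF x] norm_blinfun.rep_eq)
      also have "\<dots> \<le> norm (D z) + norm (D x - D z)"
        by (metis norm_triangle_sub)
      also have "norm (D x - D z) \<le> C * dist x z powr \<alpha>"
        by (rule C[OF xz])
      also have "\<dots> \<le> \<bar>C\<bar> * dist x z powr \<alpha>"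
        by (intro mult_right_mono) auto
      also have "\<dots> \<le> \<bar>C\<bar> * d powr \<alpha>"
        using d[OF x] \<alpha> by (intro mult_left_mono powr_mono2) auto
      finally show ?thesis by simp
    qed
    then show ?thesis by (intro bdd_aboveI2)
  qed simp
  have "onorm (\<lambda>v. fderiv f x v - fderiv f y v) / dist x y powr \<alpha> \<le> C"
    if "x \<in> U" "y \<in> U" "x \<noteq> y" for x y
  proof -
    have xy: "x \<in> closure U" "y \<in> closure U"
      using that closure_subset by auto
    have "onorm (\<lambda>v. fderiv f x v - fderiv f y v) = norm (D x - D y)"
      using that by (simp add: fd norm_blinfun.rep_eq minus_blinfun.rep_eq)
    then show ?thesis
      using C[OF xy] that by (simp add: divide_le_eq)
  qed
  then show "bdd_above ((\<lambda>(x, y). onorm (\<lambda>v. fderiv f x v - fderiv f y v) / dist x y powr \<alpha>) `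
          {(x, y). x \<in> U \<and> y \<in> U \<and> x \<noteq> y})"
    by (intro bdd_aboveI2[of _ _ C]) auto
qed

lemma open_obtain_other_point:
  fixes U :: "'a::euclidean_space set"
  assumes "open U" "x \<in> U"
  obtains y where "y \<in> U" "y \<noteq> x"
proof -
  have "x islimpt U"
    using assms by (simp add: interior_limit_point interior_open)
  then show ?thesis
    using that by (metis UNIV_I islimpt_def open_UNIV)
qed

lemma C1a_part_bounds:
  fixes f :: "'a::euclidean_space \<Rightarrow> 'b::euclidean_space"
  assumes U: "bounded U" "open U" and \<alpha>: "0 \<le> \<alpha>" and f: "C1a_on \<alpha> U f" and x: "x \<in> U"
  shows norm_le_sup_part: "norm (f x) \<le> sup_part U f"
    and norm_fderiv_le_deriv_part: "norm (fderiv f x v) \<le> deriv_part U f * norm v"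
    and norm_fderiv_diff_le_hoelder_part: "y \<in> U \<Longrightarrow>
      norm (fderiv f x v - fderiv f y v) \<le> hoelder_part \<alpha> U f * dist x y powr \<alpha> * norm v"
    and sup_part_nonneg: "0 \<le> sup_part U f"
    and deriv_part_nonneg: "0 \<le> deriv_part U f"
    and hoelder_part_nonneg: "0 \<le> hoelder_part \<alpha> U f"
proof -
  note bdd = C1a_on_bdd_above[OF U(1) \<alpha> f]
  have bl: "bounded_linear (fderiv f z)" if "z \<in> U" for z
    using C1a_on_has_fderiv[OF f that] by (rule has_derivative_bounded_linear)
  show sup: "norm (f x) \<le> sup_part U f"
    unfolding sup_part_def by (rule cSUP_upper[OF x bdd(1)])
  then show "0 \<le> sup_part U f"
    by (rule order.trans[OF norm_ge_zero])
  have der: "onorm (fderiv f x) \<le> deriv_part U f"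
    unfolding deriv_part_def by (rule cSUP_upper[OF x bdd(2)])
  then show "0 \<le> deriv_part U f"
    by (rule order.trans[OF onorm_pos_le[OF bl[OF x]]])
  show "norm (fderiv f x v) \<le> deriv_part U f * norm v"
    by (rule order.trans[OF onorm[OF bl[OF x]]]) (intro mult_right_mono der norm_ge_zero)
  have hol: "onorm (\<lambda>v. fderiv f x v - fderiv f y v) / dist x y powr \<alpha> \<le> hoelder_part \<alpha> U f"
    if "y \<in> U" "y \<noteq> x" for y
    unfolding hoelder_part_def
    using cSUP_upper[OF _ bdd(3), of "(x, y)"] that x by auto
  show "norm (fderiv f x v - fderiv f y v) \<le> hoelder_part \<alpha> U f * dist x y powr \<alpha> * norm v"
    if "y \<in> U"
  proof (cases "y = x")
    case False
    have "norm (fderiv f x v - fderiv f y v) \<le> onorm (\<lambda>v. fderiv f x v - fderiv f y v) * norm v"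
      using onorm[OF bounded_linear_sub[OF bl[OF x] bl[OF that]]] .
    also have "\<dots> \<le> hoelder_part \<alpha> U f * dist x y powr \<alpha> * norm v"
      using hol[OF that False] False by (intro mult_right_mono) (simp_all add: divide_le_eq)
    finally show ?thesis .
  qed simp
  obtain y where y: "y \<in> U" "y \<noteq> x"
    using open_obtain_other_point[OF U(2) x] .
  show "0 \<le> hoelder_part \<alpha> U f"
    using onorm_pos_le[OF bounded_linear_sub[OF bl[OF x] bl[OF y(1)]]]
    by (intro order.trans[OF _ hol[OF y]]) simp
qed

lemma C1a_norm_bounds:
  fixes f :: "'a::euclidean_space \<Rightarrow> 'b::euclidean_space"
  assumes "bounded U" "open U" "0 \<le> \<alpha>" "C1a_on \<alpha> U f" and x: "x \<in> U"
  shows norm_le_C1a_norm: "norm (f x) \<le> C1a_norm \<alpha> U f"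
    and norm_fderiv_le_C1a_norm: "norm (fderiv f x v) \<le> C1a_norm \<alpha> U f * norm v"
    and norm_fderiv_diff_le_C1a_norm: "y \<in> U \<Longrightarrow>
      norm (fderiv f x v - fderiv f y v) \<le> C1a_norm \<alpha> U f * dist x y powr \<alpha> * norm v"
    and C1a_norm_nonneg: "0 \<le> C1a_norm \<alpha> U f"
proof -
  note * = C1a_part_bounds[OF assms]
  show "norm (f x) \<le> C1a_norm \<alpha> U f" "0 \<le> C1a_norm \<alpha> U f"
    using * unfolding C1a_norm_parts by auto
  show "norm (fderiv f x v) \<le> C1a_norm \<alpha> U f * norm v"
    by (rule order.trans[OF *(2)]) (use * in \<open>auto intro!: mult_right_mono simp: C1a_norm_parts\<close>)
  show "norm (fderiv f x v - fderiv f y v) \<le> C1a_norm \<alpha> U f * dist x y powr \<alpha> * norm v"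
    if "y \<in> U"
    by (rule order.trans[OF *(3)[OF that]])
      (use * in \<open>auto intro!: mult_right_mono simp: C1a_norm_parts\<close>)
qed

lemma C1a_norm_leI:
  fixes f :: "'a::euclidean_space \<Rightarrow> 'b::euclidean_space"
  assumes U: "open U" "U \<noteq> {}"
    and der: "\<And>x. x \<in> U \<Longrightarrow> (f has_derivative f' x) (at x)"
    and a: "\<And>x. x \<in> U \<Longrightarrow> norm (f x) \<le> a"
    and b: "\<And>x v. x \<in> U \<Longrightarrow> norm (f' x v) \<le> b * norm v" "0 \<le> b"
    and c: "\<And>x y v. x \<in> U \<Longrightarrow> y \<in> U \<Longrightarrow>
      norm (f' x v - f' y v) \<le> c * dist x y powr \<alpha> * norm v" "0 \<le> c"
  shows "C1a_norm \<alpha> U f \<le> a + b + c"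
  unfolding C1a_norm_parts
proof (intro add_mono)
  have fd: "fderiv f x = f' x" if "x \<in> U" for x
    using frechet_derivative_at[OF der[OF that]] by simp
  show "sup_part U f \<le> a"
    unfolding sup_part_def by (rule cSUP_least[OF U(2) a])
  show "deriv_part U f \<le> b"
    unfolding deriv_part_def
    by (rule cSUP_least[OF U(2)]) (auto simp: fd intro!: onorm_bound b)
  obtain x y where "x \<in> U" "y \<in> U" "y \<noteq> x"
    using U open_obtain_other_point[OF U(1)] by blast
  then have ne: "{(x, y). x \<in> U \<and> y \<in> U \<and> x \<noteq> y} \<noteq> {}"
    by auto
  show "hoelder_part \<alpha> U f \<le> c"
    unfolding hoelder_part_def
    by (rule cSUP_least[OF ne])
      (auto simp: fd divide_le_eq intro!: onorm_bound c mult_nonneg_nonneg)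
qed

text \<open>
  The arguments about analytic maps below use only these properties, and they are shared by the
  norm on a domain and by the one on its boundary.
\<close>

definition seminorm_on :: "'v::real_vector set \<Rightarrow> ('v \<Rightarrow> real) \<Rightarrow> bool" where
  "seminorm_on X N \<longleftrightarrow> subspace X \<and> (\<forall>x\<in>X. 0 \<le> N x) \<and>
     (\<forall>x\<in>X. \<forall>y\<in>X. N (x + y) \<le> N x + N y) \<and> (\<forall>x\<in>X. \<forall>c. N (c *\<^sub>R x) \<le> \<bar>c\<bar> * N x)"

lemma C1a_norm_add_le:
  fixes f g :: "'a::euclidean_space \<Rightarrow> 'b::euclidean_space"
  assumes U: "bounded U" "open U" "U \<noteq> {}" and \<alpha>: "0 \<le> \<alpha>"
    and f: "C1a_on \<alpha> U f" and g: "C1a_on \<alpha> U g"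
  shows "C1a_norm \<alpha> U (f + g) \<le> C1a_norm \<alpha> U f + C1a_norm \<alpha> U g"
proof -
  note F = C1a_part_bounds[OF U(1,2) \<alpha> f] and G = C1a_part_bounds[OF U(1,2) \<alpha> g]
  obtain x0 where x0: "x0 \<in> U" using U(3) by blast
  have "C1a_norm \<alpha> U (\<lambda>x. f x + g x) \<le> (sup_part U f + sup_part U g) +
      (deriv_part U f + deriv_part U g) + (hoelder_part \<alpha> U f + hoelder_part \<alpha> U g)"
  proof (rule C1a_norm_leI[OF U(2,3)])
    show "((\<lambda>x. f x + g x) has_derivative (\<lambda>v. fderiv f x v + fderiv g x v)) (at x)"
      if "x \<in> U" for x
      by (intro has_derivative_add C1a_on_has_fderiv[OF f] C1a_on_has_fderiv[OF g] that)
    show "norm (f x + g x) \<le> sup_part U f + sup_part U g" if "x \<in> U" for x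
      by (intro norm_triangle_mono F(1) G(1) that)
    show "norm (fderiv f x v + fderiv g x v) \<le> (deriv_part U f + deriv_part U g) * norm v"
      if "x \<in> U" for x v
      using norm_triangle_mono[OF F(2) G(2), OF that that, of v v] by (simp add: algebra_simps)
    show "norm (fderiv f x v + fderiv g x v - (fderiv f y v + fderiv g y v))
        \<le> (hoelder_part \<alpha> U f + hoelder_part \<alpha> U g) * dist x y powr \<alpha> * norm v"
      if "x \<in> U" "y \<in> U" for x y v
      using norm_triangle_mono[OF F(3) G(3), OF that that, of v v]
      by (simp add: algebra_simps)
  qed (use F[OF x0] G[OF x0] in auto)
  then show ?thesis
    by (simp add: C1a_norm_parts plus_fun_def)
qed

lemma C1a_norm_scaleR_le:
  fixes f :: "'a::euclidean_space \<Rightarrow> 'b::euclidean_space"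
  assumes U: "bounded U" "open U" "U \<noteq> {}" and \<alpha>: "0 \<le> \<alpha>" and f: "C1a_on \<alpha> U f"
  shows "C1a_norm \<alpha> U (c *\<^sub>R f) \<le> \<bar>c\<bar> * C1a_norm \<alpha> U f"
proof -
  note F = C1a_part_bounds[OF U(1,2) \<alpha> f]
  obtain x0 where x0: "x0 \<in> U" using U(3) by blast
  have "C1a_norm \<alpha> U (\<lambda>x. c *\<^sub>R f x) \<le>
      \<bar>c\<bar> * sup_part U f + \<bar>c\<bar> * deriv_part U f + \<bar>c\<bar> * hoelder_part \<alpha> U f"
  proof (rule C1a_norm_leI[OF U(2,3)])
    show "((\<lambda>x. c *\<^sub>R f x) has_derivative (\<lambda>v. c *\<^sub>R fderiv f x v)) (at x)"
      if "x \<in> U" for x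
      by (intro has_derivative_scaleR_right C1a_on_has_fderiv[OF f] that)
    show "norm (c *\<^sub>R f x) \<le> \<bar>c\<bar> * sup_part U f" if "x \<in> U" for x
      using F(1)[OF that] by (simp add: mult_left_mono)
    show "norm (c *\<^sub>R fderiv f x v) \<le> \<bar>c\<bar> * deriv_part U f * norm v"
      if "x \<in> U" for x v
      using F(2)[OF that] by (simp add: mult_left_mono mult.assoc)
    show "norm (c *\<^sub>R fderiv f x v - c *\<^sub>R fderiv f y v)
        \<le> \<bar>c\<bar> * hoelder_part \<alpha> U f * dist x y powr \<alpha> * norm v"
      if "x \<in> U" "y \<in> U" for x y v
      using mult_left_mono[OF F(3)[OF that], of "\<bar>c\<bar>" v]
      by (simp flip: scaleR_diff_right add: mult.assoc)
  qed (use F[OF x0] in auto)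
  then show ?thesis
    by (simp add: C1a_norm_parts scaleR_fun_def algebra_simps)
qed

lemma subspace_C1a_space:
  assumes "0 \<le> \<alpha>"
  shows "subspace (C1a_space \<alpha> U :: ('a::euclidean_space \<Rightarrow> 'b::euclidean_space) set)"
proof -
  have "C1a_on \<alpha> U (0 :: 'a \<Rightarrow> 'b)"
    unfolding zero_fun_def by (rule C1a_onI[where f' = "\<lambda>_ _. 0" and C = 0]) auto
  then show ?thesis
    unfolding subspace_def C1a_space_def
    using C1a_on_add[OF assms] C1a_on_scaleR by (auto simp: plus_fun_def scaleR_fun_def zero_fun_def)
qed

lemma seminorm_on_C1a_norm:
  assumes U: "bounded U" "open U" "U \<noteq> {}" and \<alpha>: "0 \<le> \<alpha>"
  shows "seminorm_on (C1a_space \<alpha> U :: ('a::euclidean_space \<Rightarrow> 'b::euclidean_space) set)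
           (C1a_norm \<alpha> U)"
  unfolding seminorm_on_def
  using subspace_C1a_space[OF \<alpha>] C1a_norm_add_le[OF U \<alpha>] C1a_norm_scaleR_le[OF U \<alpha>]
    C1a_norm_nonneg[OF U(1,2) \<alpha>] U(3)
  by (auto simp: C1a_space_def)

text \<open>
  The norm on the boundary is a sum of norms over cylinders; these are domains to which the
  preceding lemmas apply.
\<close>

lemma
  assumes "norm (axis c) = 1" "0 < radius c" "0 < height c"
  shows open_cylinder: "open (cylinder c)"
    and bounded_cylinder: "bounded (cylinder c)"
    and cylinder_nonempty: "cylinder c \<noteq> {}"
proof -
  show "open (cylinder c)"
    unfolding cylinder_def horizontal_def
    by (intro open_Collect_conj open_Collect_less continuous_intros)
  show "bounded (cylinder c)"
  proof (rule boundedI)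
    fix x assume x: "x \<in> cylinder c"
    have "norm x = norm (horizontal c x + (x \<bullet> axis c) *\<^sub>R axis c)"
      by (simp add: horizontal_def)
    also have "\<dots> \<le> norm (horizontal c x) + \<bar>x \<bullet> axis c\<bar>"
      using norm_triangle_ineq[of "horizontal c x" "(x \<bullet> axis c) *\<^sub>R axis c"] assms by simp
    also have "\<dots> \<le> radius c + height c"
      using x by (simp add: cylinder_def)
    finally show "norm x \<le> radius c + height c" .
  qed
  show "cylinder c \<noteq> {}"
    using assms by (auto simp: cylinder_def horizontal_def intro!: exI[of _ 0])
qed

lemma seminorm_on_C1a_boundary_norm:
  fixes \<Omega> :: "'a::euclidean_space set"
  assumes \<alpha>: "0 \<le> \<alpha>" and atlas: "is_finite_atlas \<alpha> \<Omega> \<C>"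
  shows "seminorm_on (C1a_boundary_space \<alpha> \<Omega> :: ('a \<Rightarrow> 'b::euclidean_space) set)
           (C1a_boundary_norm \<alpha> \<C>)"
proof -
  have add: "(f + g) \<circ> p = (f \<circ> p) + (g \<circ> p)" and scale: "(k *\<^sub>R f) \<circ> p = k *\<^sub>R (f \<circ> p)"
    for f g :: "'a \<Rightarrow> 'b" and p :: "'a \<Rightarrow> 'a" and k
    by (auto simp: fun_eq_iff scaleR_fun_def plus_fun_def)
  have chart: "is_boundary_chart \<alpha> \<Omega> c" if "c \<in> \<C>" for c
    using atlas that by (auto simp: is_finite_atlas_def)
  have cyl: "bounded (cylinder c)" "open (cylinder c)" "cylinder c \<noteq> {}"
    if "c \<in> \<C>" for c
    using bounded_cylinder[of c] open_cylinder[of c] cylinder_nonempty[of c] chart[OF that]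
    by (auto simp: is_boundary_chart_def)
  have on: "C1a_on \<alpha> (cylinder c) (f \<circ> parametrization c)"
    if "c \<in> \<C>" "f \<in> C1a_boundary_space \<alpha> \<Omega>" for c and f :: "'a \<Rightarrow> 'b"
    using chart that by (auto simp: C1a_boundary_space_def)
  have "C1a_on \<alpha> V ((0 :: 'a \<Rightarrow> 'b) \<circ> p)" for V :: "'a set" and p :: "'a \<Rightarrow> 'a"
    using subspace_0[OF subspace_C1a_space[OF \<alpha>, of V]]
    by (simp add: C1a_space_def comp_def zero_fun_def)
  then have zero: "(0 :: 'a \<Rightarrow> 'b) \<in> C1a_boundary_space \<alpha> \<Omega>"
    by (simp add: C1a_boundary_space_def)
  have "subspace (C1a_boundary_space \<alpha> \<Omega> :: ('a \<Rightarrow> 'b) set)"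
  proof (rule subspaceI[OF zero])
    fix f g :: "'a \<Rightarrow> 'b" and k
    assume f: "f \<in> C1a_boundary_space \<alpha> \<Omega>" and g: "g \<in> C1a_boundary_space \<alpha> \<Omega>"
    show "f + g \<in> C1a_boundary_space \<alpha> \<Omega>"
      unfolding C1a_boundary_space_def mem_Collect_eq add
      using f g by (auto simp: C1a_boundary_space_def plus_fun_def[of f g] intro!: C1a_on_add[OF \<alpha>])
    show "k *\<^sub>R f \<in> C1a_boundary_space \<alpha> \<Omega>"
      unfolding C1a_boundary_space_def mem_Collect_eq scale
      using f by (auto simp: C1a_boundary_space_def scaleR_fun_def[of k f] intro!: C1a_on_scaleR)
  qed
  moreover have "0 \<le> C1a_boundary_norm \<alpha> \<C> f" if "f \<in> C1a_boundary_space \<alpha> \<Omega>" for f :: "'a \<Rightarrow> 'b"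
    unfolding C1a_boundary_norm_def
    using cyl on[OF _ that] C1a_norm_nonneg[OF _ _ \<alpha>] by (intro sum_nonneg) blast
  moreover have "C1a_boundary_norm \<alpha> \<C> (f + g) \<le> C1a_boundary_norm \<alpha> \<C> f + C1a_boundary_norm \<alpha> \<C> g"
    if "f \<in> C1a_boundary_space \<alpha> \<Omega>" "g \<in> C1a_boundary_space \<alpha> \<Omega>" for f g :: "'a \<Rightarrow> 'b"
    unfolding C1a_boundary_norm_def add sum.distrib[symmetric]
    by (intro sum_mono C1a_norm_add_le cyl \<alpha> on that)
  moreover have "C1a_boundary_norm \<alpha> \<C> (k *\<^sub>R f) \<le> \<bar>k\<bar> * C1a_boundary_norm \<alpha> \<C> f"
    if "f \<in> C1a_boundary_space \<alpha> \<Omega>" for f :: "'a \<Rightarrow> 'b" and k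
    unfolding C1a_boundary_norm_def scale sum_distrib_left
    by (intro sum_mono C1a_norm_scaleR_le cyl \<alpha> on that)
  ultimately show ?thesis
    unfolding seminorm_on_def by blast
qed

section \<open>Real analytic maps between seminormed spaces\<close>

lemma seminorm_onD:
  assumes "seminorm_on X N"
  shows seminorm_on_subspace: "subspace X"
    and seminorm_on_nonneg: "x \<in> X \<Longrightarrow> 0 \<le> N x"
    and seminorm_on_add: "x \<in> X \<Longrightarrow> y \<in> X \<Longrightarrow> N (x + y) \<le> N x + N y"
    and seminorm_on_scaleR: "x \<in> X \<Longrightarrow> N (c *\<^sub>R x) \<le> \<bar>c\<bar> * N x"
    and seminorm_on_0: "N 0 = 0"
  using assms unfolding seminorm_on_def
proof -
  assume *: "subspace X \<and> (\<forall>x\<in>X. 0 \<le> N x) \<and>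
     (\<forall>x\<in>X. \<forall>y\<in>X. N (x + y) \<le> N x + N y) \<and> (\<forall>x\<in>X. \<forall>c. N (c *\<^sub>R x) \<le> \<bar>c\<bar> * N x)"
  then have "0 \<in> X" by (simp add: subspace_0)
  then have "0 \<le> N 0" "N (0 *\<^sub>R 0) \<le> \<bar>0\<bar> * N 0"
    using * by blast+
  then show "N 0 = 0" by simp
qed auto

lemma seminorm_on_minus_commute:
  assumes "seminorm_on X N" "x \<in> X" "y \<in> X"
  shows "N (x - y) = N (y - x)"
proof -
  have "N (x - y) \<le> N (y - x)" if "x \<in> X" "y \<in> X" for x y
    using seminorm_on_scaleR[OF assms(1) subspace_diff[OF seminorm_on_subspace[OF assms(1)] that(2,1)], of "-1"]
    by simp
  from this[OF assms(2,3)] this[OF assms(3,2)] show ?thesis by simp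
qed

lemma seminorm_on_diff_triangle:
  assumes "seminorm_on X N" "x \<in> X" "y \<in> X" "z \<in> X"
  shows "N (x - z) \<le> N (x - y) + N (y - z)"
  using seminorm_on_add[OF assms(1), of "x - y" "y - z"] assms
  by (simp add: subspace_diff seminorm_on_subspace)

lemma seminorm_on_sum:
  assumes "seminorm_on X N" "\<And>i. i \<in> I \<Longrightarrow> f i \<in> X"
  shows "N (sum f I) \<le> (\<Sum>i\<in>I. N (f i))"
  using assms(2)
proof (induction I rule: infinite_finite_induct)
  case (insert i I)
  then have "sum f I \<in> X"
    by (intro subspace_sum seminorm_on_subspace[OF assms(1)]) auto
  then show ?case
    using insert seminorm_on_add[OF assms(1), of "f i" "sum f I"] by auto
qed (auto simp: seminorm_on_0[OF assms(1)])

lemma symmetric_multilinearD: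
  assumes "symmetric_multilinear k X Y A" and h: "h \<in> {..<k} \<rightarrow> X"
  shows symmetric_multilinear_mem: "A h \<in> Y"
    and symmetric_multilinear_local: "(\<And>i. i < k \<Longrightarrow> g i = h i) \<Longrightarrow> A g = A h"
    and symmetric_multilinear_linear: "i < k \<Longrightarrow> u \<in> X \<Longrightarrow> v \<in> X \<Longrightarrow>
      A (h(i := a *\<^sub>R u + b *\<^sub>R v)) = a *\<^sub>R A (h(i := u)) + b *\<^sub>R A (h(i := v))"
    and symmetric_multilinear_permute: "p permutes {..<k} \<Longrightarrow> A (h \<circ> p) = A h"
  using bspec[OF assms(1)[unfolded symmetric_multilinear_def] h] by blast+

lemma real_analytic_map_expansion:
  assumes "real_analytic_map X NX Y NY U F" "u \<in> U"
  obtains r A M where "0 < r"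
    and "\<And>k. symmetric_multilinear k X Y (A k)"
    and "\<And>k. 0 \<le> M k"
    and "\<And>k h. h \<in> {..<k} \<rightarrow> X \<Longrightarrow> NY (A k h) \<le> M k * (\<Prod>i<k. NX (h i))"
    and "summable (\<lambda>k. M k * r ^ k)"
    and "\<And>v. v \<in> U \<Longrightarrow> NX (v - u) < r \<Longrightarrow>
           (\<lambda>m. NY (F v - (\<Sum>k<m. A k (\<lambda>_. v - u)))) \<longlonglongrightarrow> 0"
  using bspec[OF conjunct2[OF conjunct2[OF assms(1)[unfolded real_analytic_map_def]]] assms(2)]
  apply (elim exE conjE)
  subgoal premises prems for r A M
    using prems(2-) by (intro that[of r A M]) simp_all
  done

text \<open>
  All terms of the series beyond the constant one carry a factor \<open>NX (v - u)\<close>, so that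
  \<open>NY (F v - F u)\<close> is at most a constant times \<open>NX (v - u)\<close> for \<open>v\<close> near \<open>u\<close>.
\<close>

lemma real_analytic_map_continuous:
  assumes X: "seminorm_on X NX" and Y: "seminorm_on Y NY"
    and an: "real_analytic_map X NX Y NY U F" and u: "u \<in> U" and "0 < e"
  shows "\<exists>d>0. \<forall>v\<in>U. NX (v - u) < d \<longrightarrow> NY (F v - F u) < e"
proof -
  obtain r A M where r: "0 < r"
    and A: "\<And>k. symmetric_multilinear k X Y (A k)"
    and M0: "\<And>k. 0 \<le> M k"
    and M: "\<And>k h. h \<in> {..<k} \<rightarrow> X \<Longrightarrow> NY (A k h) \<le> M k * (\<Prod>i<k. NX (h i))"
    and sm: "summable (\<lambda>k. M k * r ^ k)"
    and lim: "\<And>v. v \<in> U \<Longrightarrow> NX (v - u) < r \<Longrightarrow>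
           (\<lambda>m. NY (F v - (\<Sum>k<m. A k (\<lambda>_. v - u)))) \<longlonglongrightarrow> 0"
    apply (rule real_analytic_map_expansion[OF an u])
    subgoal premises prems for r A M by (rule prems(1)[OF prems(2-7)])
    done
  have UX: "U \<subseteq> X" and FY: "F ` U \<subseteq> Y"
    using an unfolding real_analytic_map_def by auto
  define B where "B = (\<Sum>k. M k * r ^ k)"
  have B0: "0 \<le> B"
    unfolding B_def using M0 r by (intro suminf_nonneg sm) auto
  have AY: "A k (\<lambda>_. w) \<in> Y" if "w \<in> X" for k w
    by (rule symmetric_multilinear_mem[OF A]) (use that in simp)
  have A0: "A 0 g = A 0 h" for g h
    by (rule symmetric_multilinear_local[OF A]) auto
  have key: "NY (F v - A 0 (\<lambda>_. v - u)) \<le> B * (NX (v - u) / r)"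
    if v: "v \<in> U" "NX (v - u) < r" for v
  proof -
    define w where "w = v - u"
    have w: "w \<in> X" unfolding w_def
      using v u UX by (intro subspace_diff seminorm_on_subspace[OF X]) auto
    have t: "0 \<le> NX w" "NX w < r"
      using seminorm_on_nonneg[OF X w] v by (auto simp: w_def)
    have term_le: "NY (A (Suc k) (\<lambda>_. w)) \<le> M (Suc k) * r ^ Suc k * (NX w / r)" for k
    proof -
      have "NY (A (Suc k) (\<lambda>_. w)) \<le> M (Suc k) * (NX w ^ k * NX w)"
        using M[of "\<lambda>_. w" "Suc k"] w by (simp add: mult.commute)
      also have "\<dots> \<le> M (Suc k) * (r ^ k * NX w)"
        using t M0 by (intro mult_left_mono mult_right_mono power_mono) auto
      finally show ?thesis using r by simp
    qed
    \<comment> \<open>A partial sum differs from its constant term by at most the sum of the majorants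
      \<open>M k * r ^ k\<close>, damped by the factor \<open>NX w / r\<close> from \<open>term_le\<close>.\<close>
    have part: "NY (F v - A 0 (\<lambda>_. w)) \<le> NY (F v - (\<Sum>k<Suc m. A k (\<lambda>_. w))) + B * (NX w / r)" for m
    proof -
      have split: "(\<Sum>k<Suc m. A k (\<lambda>_. w)) - A 0 (\<lambda>_. w) = (\<Sum>k<m. A (Suc k) (\<lambda>_. w))"
        by (simp add: sum.lessThan_Suc_shift del: sum.lessThan_Suc)
      have S: "(\<Sum>k<Suc m. A k (\<lambda>_. w)) \<in> Y"
        by (intro subspace_sum seminorm_on_subspace[OF Y] AY w)
      have "NY (\<Sum>k<m. A (Suc k) (\<lambda>_. w)) \<le> (\<Sum>k<m. NY (A (Suc k) (\<lambda>_. w)))"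
        by (intro seminorm_on_sum[OF Y] AY w)
      also have "\<dots> \<le> (\<Sum>k<m. M (Suc k) * r ^ Suc k * (NX w / r))"
        by (intro sum_mono term_le)
      also have "\<dots> = (\<Sum>k\<in>Suc ` {..<m}. M k * r ^ k) * (NX w / r)"
        by (subst sum.reindex[OF inj_Suc]) (simp only: sum_distrib_right o_def)
      also have "\<dots> \<le> B * (NX w / r)"
        unfolding B_def using M0 r t by (intro mult_right_mono sum_le_suminf sm) auto
      finally show ?thesis
        using seminorm_on_diff_triangle[OF Y _ S AY[OF w, of 0], of "F v"] split FY v by auto
    qed
    have "(\<lambda>m. NY (F v - (\<Sum>k<Suc m. A k (\<lambda>_. w))) + B * (NX w / r)) \<longlonglongrightarrow> 0 + B * (NX w / r)"
      using LIMSEQ_Suc[OF lim[OF v]] unfolding w_def by (intro tendsto_intros)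
    then have "NY (F v - A 0 (\<lambda>_. w)) \<le> 0 + B * (NX w / r)"
      using part by (intro LIMSEQ_le_const) auto
    then show ?thesis by (simp add: w_def)
  qed
  \<comment> \<open>\<open>NY\<close> is only a seminorm, so \<open>F u\<close> and the constant term agree only up to \<open>NY\<close>-distance \<open>0\<close>.\<close>
  have "NY (F u - A 0 (\<lambda>_. 0)) \<le> 0"
    using key[OF u] seminorm_on_0[OF X] r by simp
  then have Fu: "NY (A 0 (\<lambda>_. 0) - F u) \<le> 0"
    using seminorm_on_minus_commute[OF Y, of "F u" "A 0 (\<lambda>_. 0)"]
      AY subspace_0[OF seminorm_on_subspace[OF X]] u FY by auto
  define d where "d = min r (e * r / (B + 1))"
  have "NY (F v - F u) < e" if v: "v \<in> U" and d: "NX (v - u) < d" for v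
  proof -
    have vr: "NX (v - u) < r" "NX (v - u) < e * r / (B + 1)"
      using d by (auto simp: d_def)
    have "v - u \<in> X"
      using v u UX by (intro subspace_diff seminorm_on_subspace[OF X]) auto
    then have pos: "0 \<le> NX (v - u)" by (rule seminorm_on_nonneg[OF X])
    have "NY (F v - F u) \<le> NY (F v - A 0 (\<lambda>_. 0)) + NY (A 0 (\<lambda>_. 0) - F u)"
      using AY subspace_0[OF seminorm_on_subspace[OF X]] u v FY
      by (intro seminorm_on_diff_triangle[OF Y]) auto
    also have "\<dots> \<le> B * (NX (v - u) / r)"
      using key[OF v vr(1)] Fu A0[of "\<lambda>_. v - u" "\<lambda>_. 0"] by simp
    also have "\<dots> \<le> (B + 1) * (NX (v - u) / r)"
      using pos r by (intro mult_right_mono) auto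
    also have "\<dots> < e"
      using vr(2) B0 r by (simp add: field_simps)
    finally show ?thesis .
  qed
  moreover have "0 < d"
    using r B0 \<open>0 < e\<close> by (simp add: d_def)
  ultimately show ?thesis by blast
qed

lemma relatively_open_preimage_ball:
  assumes X: "seminorm_on X NX" and Y: "seminorm_on Y NY"
    and an: "real_analytic_map X NX Y NY X F"
    and V: "relatively_open NX A V" "A \<subseteq> X" and y: "y \<in> Y"
  shows "relatively_open NX A {v \<in> V. NY (F v - y) < e}"
  unfolding relatively_open_def
proof (intro conjI ballI)
  show "{v \<in> V. NY (F v - y) < e} \<subseteq> A"
    using V by (auto simp: relatively_open_def)
  fix u assume u: "u \<in> {v \<in> V. NY (F v - y) < e}"
  then have uX: "u \<in> X"
    using V by (auto simp: relatively_open_def)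
  obtain d1 where d1: "d1 > 0" "\<And>v. v \<in> A \<Longrightarrow> NX (v - u) < d1 \<Longrightarrow> v \<in> V"
    using u V by (auto simp: relatively_open_def)
  have "0 < e - NY (F u - y)" using u by simp
  from real_analytic_map_continuous[OF X Y an uX this]
  obtain d2 where d2: "d2 > 0" "\<And>v. v \<in> X \<Longrightarrow> NX (v - u) < d2 \<Longrightarrow> NY (F v - F u) < e - NY (F u - y)"
    by blast
  have FY: "F ` X \<subseteq> Y"
    using an by (auto simp: real_analytic_map_def)
  have "v \<in> {v \<in> V. NY (F v - y) < e}" if v: "v \<in> A" "NX (v - u) < min d1 d2" for v
  proof -
    have "v \<in> X" using v V by auto
    then have "NY (F v - y) \<le> NY (F v - F u) + NY (F u - y)"
      using FY uX y by (intro seminorm_on_diff_triangle[OF Y]) auto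
    then show ?thesis
      using d1 d2(2)[OF \<open>v \<in> X\<close>] v by auto
  qed
  then show "\<exists>\<epsilon>>0. \<forall>v\<in>A. NX (v - u) < \<epsilon> \<longrightarrow> v \<in> {v \<in> V. NY (F v - y) < e}"
    using d1 d2 by (intro exI[of _ "min d1 d2"]) auto
qed

text \<open>
  A bounded linear map is applied to each term of the series; the constant \<open>c\<close> joins the term of
  order \<open>0\<close>. From the first partial sum on, \<open>c\<close> cancels in the remainder, which is the image of the
  old one.
\<close>

lemma real_analytic_map_affine_comp:
  assumes Y: "seminorm_on Y NY" and Z: "seminorm_on Z NZ" and X: "subspace X"
    and an: "real_analytic_map X NX Y NY U F" and WU: "W \<subseteq> U"
    and L: "linear L" "\<And>y. y \<in> Y \<Longrightarrow> L y \<in> Z" "\<And>y. y \<in> Y \<Longrightarrow> NZ (L y) \<le> C * NY y" "0 \<le> C"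
    and c: "c \<in> Z"
  shows "real_analytic_map X NX Z NZ W (\<lambda>v. c + L (F v))"
  unfolding real_analytic_map_def
proof (intro conjI ballI)
  have UX: "U \<subseteq> X" and FY: "F ` U \<subseteq> Y"
    using an unfolding real_analytic_map_def by auto
  have Zadd: "x + y \<in> Z" if "x \<in> Z" "y \<in> Z" for x y
    using that seminorm_on_subspace[OF Z] by (simp add: subspace_add)
  show "W \<subseteq> X"
    using UX WU by auto
  show "(\<lambda>v. c + L (F v)) ` W \<subseteq> Z"
    using WU FY by (intro image_subsetI Zadd c L(2)) auto
  fix u assume u: "u \<in> W"
  then have uU: "u \<in> U" using WU by blast
  obtain r A M where r: "0 < r"
    and A: "\<And>k. symmetric_multilinear k X Y (A k)"
    and M0: "\<And>k. 0 \<le> M k"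
    and M: "\<And>k h. h \<in> {..<k} \<rightarrow> X \<Longrightarrow> NY (A k h) \<le> M k * (\<Prod>i<k. NX (h i))"
    and sm: "summable (\<lambda>k. M k * r ^ k)"
    and lim: "\<And>v. v \<in> U \<Longrightarrow> NX (v - u) < r \<Longrightarrow>
           (\<lambda>m. NY (F v - (\<Sum>k<m. A k (\<lambda>_. v - u)))) \<longlonglongrightarrow> 0"
    apply (rule real_analytic_map_expansion[OF an uU])
    subgoal premises prems for r A M by (rule prems(1)[OF prems(2-7)])
    done
  define A' where "A' k h = (if k = 0 then c + L (A k h) else L (A k h))" for k h
  define M' where "M' k = (if k = 0 then NZ c + C * M k else C * M k)" for k
  have AY: "A k h \<in> Y" if "h \<in> {..<k} \<rightarrow> X" for k h
    by (rule symmetric_multilinear_mem[OF A that])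
  have 1: "symmetric_multilinear k X Z (A' k)" for k
    unfolding symmetric_multilinear_def
  proof (intro ballI conjI allI impI)
    fix h assume h: "h \<in> {..<k} \<rightarrow> X"
    show "A' k h \<in> Z"
      using L(2)[OF AY[OF h]] Zadd[OF c L(2)[OF AY[OF h]]] unfolding A'_def by presburger
    show "A' k g = A' k h" if "\<forall>i<k. g i = h i" for g
    proof -
      have "A k g = A k h"
        using that by (intro symmetric_multilinear_local[OF A h]) simp
      then show ?thesis by (simp only: A'_def)
    qed
    show "A' k (h(i := a *\<^sub>R u + b *\<^sub>R v)) = a *\<^sub>R A' k (h(i := u)) + b *\<^sub>R A' k (h(i := v))"
      if "i < k" "u \<in> X" "v \<in> X" for i u v a b
      unfolding A'_def symmetric_multilinear_linear[OF A h that]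
      using that by (simp add: linear_add[OF L(1)] linear_scale[OF L(1)])
    show "A' k (h \<circ> p) = A' k h" if "p permutes {..<k}" for p
      unfolding A'_def symmetric_multilinear_permute[OF A h that] ..
  qed
  have 2: "0 \<le> M' k" for k
    unfolding M'_def using M0 L(4) seminorm_on_nonneg[OF Z c] by simp
  have 3: "NZ (A' k h) \<le> M' k * (\<Prod>i<k. NX (h i))" if h: "h \<in> {..<k} \<rightarrow> X" for k h
  proof -
    have "NZ (L (A k h)) \<le> C * NY (A k h)"
      by (rule L(3)[OF AY[OF h]])
    also have "\<dots> \<le> C * (M k * (\<Prod>i<k. NX (h i)))"
      by (rule mult_left_mono[OF M[OF h] L(4)])
    finally have *: "NZ (L (A k h)) \<le> C * M k * (\<Prod>i<k. NX (h i))"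
      by (simp add: mult.assoc)
    then show ?thesis
      using seminorm_on_add[OF Z c L(2)[OF AY[OF h]]] by (auto simp: A'_def M'_def)
  qed
  have 4: "summable (\<lambda>k. M' k * r ^ k)"
  proof (rule summable_comparison_test_ev)
    show "summable (\<lambda>k. C * (M k * r ^ k))"
      by (rule summable_mult[OF sm])
    show "eventually (\<lambda>k. norm (M' k * r ^ k) \<le> C * (M k * r ^ k)) sequentially"
      using eventually_gt_at_top[of 0] by eventually_elim (use M0 L(4) r in \<open>auto simp: M'_def\<close>)
  qed
  have 5: "(\<lambda>m. NZ (c + L (F v) - (\<Sum>k<m. A' k (\<lambda>_. v - u)))) \<longlonglongrightarrow> 0"
    if v: "v \<in> W" "NX (v - u) < r" for v
  proof (rule tendsto_sandwich)
    have vu: "v - u \<in> X"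
      using v u UX WU by (intro subspace_diff X) auto
    define S where "S m = (\<Sum>k<m. A k (\<lambda>_. v - u))" for m
    have SY: "F v - S m \<in> Y" for m
      unfolding S_def using vu v FY WU
      by (intro subspace_diff subspace_sum seminorm_on_subspace[OF Y] AY) auto
    have eq: "c + L (F v) - (\<Sum>k<Suc m. A' k (\<lambda>_. v - u)) = L (F v - S (Suc m))" for m
      unfolding S_def linear_diff[OF L(1)] linear_sum[OF L(1)]
      by (simp add: sum.lessThan_Suc_shift A'_def del: sum.lessThan_Suc)
    have ev: "eventually (\<lambda>m. c + L (F v) - (\<Sum>k<m. A' k (\<lambda>_. v - u)) = L (F v - S m)) sequentially"
      using eventually_gt_at_top[of 0]
    proof eventually_elim
      case (elim m)
      then show ?case using eq[of "m - 1"] by simp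
    qed
    show "eventually (\<lambda>m. 0 \<le> NZ (c + L (F v) - (\<Sum>k<m. A' k (\<lambda>_. v - u)))) sequentially"
      using ev by eventually_elim (simp add: seminorm_on_nonneg[OF Z L(2)[OF SY]])
    show "eventually (\<lambda>m. NZ (c + L (F v) - (\<Sum>k<m. A' k (\<lambda>_. v - u))) \<le> C * NY (F v - S m)) sequentially"
      using ev by eventually_elim (simp add: L(3)[OF SY])
    show "(\<lambda>m. C * NY (F v - S m)) \<longlonglongrightarrow> 0"
      using tendsto_mult_left[OF lim[of v], of C] v WU by (auto simp: S_def)
  qed simp
  show "\<exists>r>0. \<exists>A M.
        (\<forall>k. symmetric_multilinear k X Z (A k)) \<and>
        (\<forall>k. 0 \<le> M k \<and> (\<forall>h \<in> {..<k} \<rightarrow> X. NZ (A k h) \<le> M k * (\<Prod>i<k. NX (h i)))) \<and>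
        summable (\<lambda>k. M k * r ^ k) \<and>
        (\<forall>v\<in>W. NX (v - u) < r \<longrightarrow>
           (\<lambda>m. NZ (c + L (F v) - (\<Sum>k<m. A k (\<lambda>_. v - u)))) \<longlonglongrightarrow> 0)"
    by (intro exI[of _ r] exI[of _ A'] exI[of _ M'] conjI allI ballI impI r 1 2 3 4 5)
qed

section \<open>Cutoff functions\<close>

text \<open>
  A cutoff function with Lipschitz differential suffices for multiplication in spaces of class
  \<open>C\<^sup>1\<^sup>,\<^sup>\<alpha>\<close>. Bounded Lipschitz functions are closed under all operations from which the
  cutoff is built.
\<close>

definition bounded_lipschitz ::
  "'a::metric_space set \<Rightarrow> ('a \<Rightarrow> 'b::real_normed_vector) \<Rightarrow> bool" where
  "bounded_lipschitz X f \<longleftrightarrow> (\<exists>C. (\<forall>x\<in>X. norm (f x) \<le> C) \<and> (\<forall>x\<in>X. \<forall>y\<in>X. norm (f x - f y) \<le> C * dist x y))"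

lemma bounded_lipschitzE:
  assumes "bounded_lipschitz X f"
  obtains C where "0 \<le> C" "\<And>x. x \<in> X \<Longrightarrow> norm (f x) \<le> C"
    "\<And>x y. x \<in> X \<Longrightarrow> y \<in> X \<Longrightarrow> norm (f x - f y) \<le> C * dist x y"
proof -
  from assms obtain C where C: "\<forall>x\<in>X. norm (f x) \<le> C"
    "\<forall>x\<in>X. \<forall>y\<in>X. norm (f x - f y) \<le> C * dist x y"
    unfolding bounded_lipschitz_def by blast
  have "norm (f x - f y) \<le> max C 0 * dist x y" if "x \<in> X" "y \<in> X" for x y
    by (rule order.trans[OF C(2)[rule_format, OF that]]) (auto intro: mult_right_mono)
  with C show ?thesis
    by (intro that[of "max C 0"]) auto
qed

lemma bounded_lipschitz_const [simp, intro]: "bounded_lipschitz X (\<lambda>_. c)"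
  unfolding bounded_lipschitz_def by (intro exI[of _ "norm c"]) auto

lemma bounded_lipschitz_ident:
  assumes "bounded X"
  shows "bounded_lipschitz X (\<lambda>x. x)"
proof -
  obtain B where B: "\<forall>x\<in>X. norm x \<le> B"
    using assms bounded_iff by blast
  have "norm (x - y) \<le> max B 1 * dist x y" for x y :: 'a
    using mult_right_mono[of 1 "max B 1" "dist x y"] by (simp add: dist_norm)
  then show ?thesis
    unfolding bounded_lipschitz_def using B by (intro exI[of _ "max B 1"]) auto
qed

lemma bounded_lipschitz_add:
  assumes "bounded_lipschitz X f" "bounded_lipschitz X g"
  shows "bounded_lipschitz X (\<lambda>x. f x + g x)"
proof -
  obtain C where C: "\<And>x. x \<in> X \<Longrightarrow> norm (f x) \<le> C"
    "\<And>x y. x \<in> X \<Longrightarrow> y \<in> X \<Longrightarrow> norm (f x - f y) \<le> C * dist x y"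
    using bounded_lipschitzE[OF assms(1)] by metis
  obtain D where D: "\<And>x. x \<in> X \<Longrightarrow> norm (g x) \<le> D"
    "\<And>x y. x \<in> X \<Longrightarrow> y \<in> X \<Longrightarrow> norm (g x - g y) \<le> D * dist x y"
    using bounded_lipschitzE[OF assms(2)] by metis
  show ?thesis
    unfolding bounded_lipschitz_def
  proof (intro exI[of _ "C + D"] conjI ballI)
    fix x y assume xy: "x \<in> X" "y \<in> X"
    show "norm (f x + g x) \<le> C + D"
      using C D xy by (intro norm_triangle_mono)
    show "norm (f x + g x - (f y + g y)) \<le> (C + D) * dist x y"
      using norm_triangle_mono[OF C(2)[OF xy] D(2)[OF xy]] by (simp add: algebra_simps)
  qed
qed

lemma bounded_lipschitz_sum:
  assumes "\<And>i. i \<in> I \<Longrightarrow> bounded_lipschitz X (f i)"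
  shows "bounded_lipschitz X (\<lambda>x. \<Sum>i\<in>I. f i x)"
  using assms
  by (induction I rule: infinite_finite_induct) (auto intro: bounded_lipschitz_add)

lemma bounded_lipschitz_bilinear:
  assumes "bounded_bilinear pr" "bounded_lipschitz X f" "bounded_lipschitz X g"
  shows "bounded_lipschitz X (\<lambda>x. pr (f x) (g x))"
proof -
  interpret bounded_bilinear pr by fact
  obtain K where K: "0 \<le> K" "\<And>a b. norm (pr a b) \<le> norm a * norm b * K"
    using nonneg_bounded by blast
  obtain C where C: "0 \<le> C" "\<And>x. x \<in> X \<Longrightarrow> norm (f x) \<le> C"
    "\<And>x y. x \<in> X \<Longrightarrow> y \<in> X \<Longrightarrow> norm (f x - f y) \<le> C * dist x y"
    using bounded_lipschitzE[OF assms(2)] by metis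
  obtain D where D: "0 \<le> D" "\<And>x. x \<in> X \<Longrightarrow> norm (g x) \<le> D"
    "\<And>x y. x \<in> X \<Longrightarrow> y \<in> X \<Longrightarrow> norm (g x - g y) \<le> D * dist x y"
    using bounded_lipschitzE[OF assms(3)] by metis
  show ?thesis
    unfolding bounded_lipschitz_def
  proof (intro exI[of _ "2 * C * D * K"] conjI ballI)
    fix x y assume xy: "x \<in> X" "y \<in> X"
    have "norm (pr (f x) (g x)) \<le> norm (f x) * norm (g x) * K" by (rule K)
    also have "\<dots> \<le> C * D * K"
      using C D K xy by (intro mult_right_mono mult_mono) auto
    also have "\<dots> \<le> 2 * C * D * K"
      using C D K by simp
    finally show "norm (pr (f x) (g x)) \<le> 2 * C * D * K" .
    have "pr (f x) (g x) - pr (f y) (g y) = pr (f x - f y) (g x) + pr (f y) (g x - g y)"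
      by (simp add: diff_left diff_right)
    also have "norm \<dots> \<le> norm (f x - f y) * norm (g x) * K + norm (f y) * norm (g x - g y) * K"
      by (intro norm_triangle_mono K)
    also have "\<dots> \<le> (C * dist x y) * D * K + C * (D * dist x y) * K"
      using C D K xy by (intro add_mono mult_right_mono mult_mono) auto
    finally show "norm (pr (f x) (g x) - pr (f y) (g y)) \<le> 2 * C * D * K * dist x y"
      by (simp add: algebra_simps)
  qed
qed

lemma bounded_lipschitz_max_0:
  fixes f :: "'a::metric_space \<Rightarrow> real"
  assumes "bounded_lipschitz X f"
  shows "bounded_lipschitz X (\<lambda>x. max 0 (f x))"
proof -
  obtain C where C: "\<And>x. x \<in> X \<Longrightarrow> norm (f x) \<le> C"
    "\<And>x y. x \<in> X \<Longrightarrow> y \<in> X \<Longrightarrow> norm (f x - f y) \<le> C * dist x y"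
    using bounded_lipschitzE[OF assms(1)] by metis
  have "norm (max 0 a - max 0 b) \<le> norm (a - b)" "norm (max 0 a) \<le> norm a" for a b :: real
    by (auto simp: max_def)
  then show ?thesis
    unfolding bounded_lipschitz_def using C by (intro exI[of _ C]) (meson order.trans)
qed

lemmas bounded_lipschitz_intros =
  bounded_lipschitz_const bounded_lipschitz_ident bounded_lipschitz_add bounded_lipschitz_sum
  bounded_lipschitz_bilinear[OF bounded_bilinear_scaleR]
  bounded_lipschitz_bilinear[OF bounded_bilinear_inner]
  bounded_lipschitz_bilinear[OF bounded_bilinear_mult]
  bounded_lipschitz_max_0

text \<open>
  The square of the positive part is the simplest function with Lipschitz derivative that
  distinguishes a half-line from its complement; it replaces a smooth bump throughout.
\<close>

lemma has_real_derivative_max_0_square: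
  "((\<lambda>t::real. (max 0 t)\<^sup>2) has_real_derivative 2 * max 0 t) (at t)"
proof (cases t "0::real" rule: linorder_cases)
  case less
  have "((\<lambda>t::real. 0) has_real_derivative 2 * max 0 t) (at t)"
    using less by simp
  then show ?thesis
    by (rule has_field_derivative_transform_within_open[of _ _ _ "{..<0}"]) (use less in auto)
next
  case greater
  have "((\<lambda>t::real. t\<^sup>2) has_real_derivative 2 * max 0 t) (at t)"
    using greater by (auto intro!: derivative_eq_intros)
  then show ?thesis
    by (rule has_field_derivative_transform_within_open[of _ _ _ "{0<..}"]) (use greater in auto)
next
  case equal
  have "((\<lambda>y. (max 0 y)\<^sup>2 / y) \<longlongrightarrow> 0) (at (0::real))"
  proof (rule Lim_null_comparison)
    show "eventually (\<lambda>y::real. norm ((max 0 y)\<^sup>2 / y) \<le> \<bar>y\<bar>) (at 0)"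
      by (auto simp: max_def power2_eq_square intro!: always_eventually)
    show "((\<lambda>y::real. \<bar>y\<bar>) \<longlongrightarrow> 0) (at 0)"
      by (auto intro!: tendsto_eq_intros)
  qed
  then show ?thesis
    using equal by (simp add: has_field_derivative_iff)
qed

lemma has_derivative_max_0_square:
  fixes f :: "'a::real_inner \<Rightarrow> real"
  assumes "(f has_derivative (\<lambda>v. G \<bullet> v)) (at x)"
  shows "((\<lambda>x. (max 0 (f x))\<^sup>2) has_derivative (\<lambda>v. ((2 * max 0 (f x)) *\<^sub>R G) \<bullet> v)) (at x)"
  using DERIV_compose_FDERIV[OF has_real_derivative_max_0_square assms]
  by (simp add: mult.commute mult.assoc)

text \<open>
  The sum \<open>S\<close> of the bumps \<open>(max 0 (r\<^sup>2 - \<bar>x - a\<bar>\<^sup>2))\<^sup>2\<close> over finitely many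
  balls that cover \<open>A\<close> and stay in \<open>V\<close> is positive on \<open>A\<close>, hence at least some \<open>m > 0\<close> there,
  and vanishes off \<open>V\<close>. The profile \<open>1 - (max 0 (1 - S / m))\<^sup>2\<close> then flattens \<open>S\<close> to
  \<open>1\<close> on \<open>A\<close> and is still \<open>0\<close> where \<open>S\<close> is.
\<close>

lemma C11_cutoff_exists:
  fixes A V X :: "'a::euclidean_space set"
  assumes A: "compact A" "A \<subseteq> V" and V: "open V" and X: "bounded X"
  obtains \<eta> :: "'a \<Rightarrow> real" and G :: "'a \<Rightarrow> 'a"
  where "\<And>x. (\<eta> has_derivative (\<lambda>v. G x \<bullet> v)) (at x)"
    and "\<And>x. x \<in> A \<Longrightarrow> \<eta> x = 1"
    and "\<And>x. x \<notin> V \<Longrightarrow> \<eta> x = 0" and "\<And>x. x \<notin> V \<Longrightarrow> G x = 0"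
    and "bounded_lipschitz X \<eta>" and "bounded_lipschitz X G"
proof -
  have "\<forall>a\<in>A. \<exists>r>0. ball a r \<subseteq> V"
    using A V open_contains_ball by blast
  then obtain r where r: "\<And>a. a \<in> A \<Longrightarrow> r a > 0" "\<And>a. a \<in> A \<Longrightarrow> ball a (r a) \<subseteq> V"
    unfolding bchoice_iff by blast
  have "A \<subseteq> (\<Union>a\<in>A. ball a (r a))"
    using r(1) by force
  then obtain I where I: "I \<subseteq> A" "finite I" "A \<subseteq> (\<Union>a\<in>I. ball a (r a))"
    by (rule compactE_image[OF A(1) open_ball])
  define f where "f = (\<lambda>a x. (r a)\<^sup>2 - (x - a) \<bullet> (x - a))"
  define S where "S = (\<lambda>x. (\<Sum>a\<in>I. (max 0 (f a x))\<^sup>2))"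
  define H where "H = (\<lambda>x. (\<Sum>a\<in>I. (2 * max 0 (f a x)) *\<^sub>R ((-2) *\<^sub>R (x - a))))"
  have f_pos: "0 < f a x \<longleftrightarrow> x \<in> ball a (r a)" if "a \<in> I" for a x
  proof -
    have "0 < r a" using that I r by auto
    then have "(norm (x - a))\<^sup>2 < (r a)\<^sup>2 \<longleftrightarrow> norm (x - a) < r a"
      by (auto intro: power2_less_imp_less power_strict_mono)
    then show ?thesis
      by (simp add: f_def dot_square_norm dist_norm norm_minus_commute)
  qed
  have f_der: "(f a has_derivative (\<lambda>v. ((-2) *\<^sub>R (x - a)) \<bullet> v)) (at x)" for a x
  proof -
    have "(f a has_derivative (\<lambda>v. 0 - ((x - a) \<bullet> (v - 0) + (v - 0) \<bullet> (x - a)))) (at x)"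
      unfolding f_def by (intro derivative_intros)
    moreover have "(\<lambda>v. 0 - ((x - a) \<bullet> (v - 0) + (v - 0) \<bullet> (x - a))) = (\<lambda>v. ((-2) *\<^sub>R (x - a)) \<bullet> v)"
      by (simp add: fun_eq_iff inner_commute[of _ "x - a"])
    ultimately show ?thesis by simp
  qed
  have S_der: "(S has_derivative (\<lambda>v. H x \<bullet> v)) (at x)" for x
    unfolding S_def H_def inner_sum_left
    by (rule has_derivative_sum) (rule has_derivative_max_0_square[OF f_der])
  have off: "max 0 (f a x) = 0" if "x \<notin> V" "a \<in> I" for a x
  proof -
    have "x \<notin> ball a (r a)" using r(2)[of a] I(1) that by blast
    then show ?thesis using f_pos[OF that(2), of x] by simp
  qed
  have S_off: "S x = 0" and H_off: "H x = 0" if "x \<notin> V" for x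
    using off[OF that] by (simp_all add: S_def H_def)
  have S_pos: "0 < S x" if x: "x \<in> A" for x
  proof -
    obtain a where a: "a \<in> I" "x \<in> ball a (r a)" using I(3) x by auto
    then have "0 < f a x" using f_pos by blast
    then have "0 < (max 0 (f a x))\<^sup>2" by simp
    then show ?thesis
      unfolding S_def using a I by (intro sum_pos2[of _ a]) auto
  qed
  obtain m where m: "0 < m" "\<And>x. x \<in> A \<Longrightarrow> m \<le> S x"
  proof (cases "A = {}")
    case False
    have "continuous_on A S"
      by (intro continuous_at_imp_continuous_on ballI has_derivative_continuous[OF S_der])
    then obtain z where "z \<in> A" "\<And>x. x \<in> A \<Longrightarrow> S z \<le> S x"
      using continuous_attains_inf[OF A(1) False] by blast
    then show ?thesis using that[of "S z"] S_pos by blast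
  qed (use that[of 1] in auto)
  define \<eta> where "\<eta> = (\<lambda>x. 1 - (max 0 (1 - S x / m))\<^sup>2)"
  define G where "G = (\<lambda>x. - ((2 * max 0 (1 - S x / m)) *\<^sub>R ((- 1 / m) *\<^sub>R H x)))"
  have "((\<lambda>x. 1 - S x / m) has_derivative (\<lambda>v. ((- 1 / m) *\<^sub>R H x) \<bullet> v)) (at x)" for x
  proof -
    have "((\<lambda>x. 1 - S x * (1 / m)) has_derivative (\<lambda>v. 0 - (H x \<bullet> v) * (1 / m))) (at x)"
      by (intro has_derivative_diff has_derivative_const has_derivative_mult_left S_der)
    then show ?thesis by simp
  qed
  note inner_der = has_derivative_max_0_square[OF this]
  have der: "(\<eta> has_derivative (\<lambda>v. G x \<bullet> v)) (at x)" for x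
  proof -
    have "(\<eta> has_derivative (\<lambda>v. 0 - ((2 * max 0 (1 - S x / m)) *\<^sub>R ((- 1 / m) *\<^sub>R H x)) \<bullet> v)) (at x)"
      unfolding \<eta>_def by (intro has_derivative_diff has_derivative_const inner_der)
    then show ?thesis by (simp add: G_def)
  qed
  have \<eta>1: "\<eta> x = 1" if "x \<in> A" for x
  proof -
    have "1 \<le> S x / m"
      using m(1) m(2)[OF that] by (simp add: le_divide_eq)
    then show ?thesis by (simp add: \<eta>_def)
  qed
  have fL: "bounded_lipschitz X (f a)" for a
  proof -
    have "f a = (\<lambda>x. (r a)\<^sup>2 + (-1) * ((x + (-a)) \<bullet> (x + (-a))))" by (simp add: f_def fun_eq_iff)
    then show ?thesis
      by (simp only:) (intro bounded_lipschitz_intros X)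
  qed
  have SL: "bounded_lipschitz X S"
    unfolding S_def power2_eq_square by (intro bounded_lipschitz_intros fL)
  have HL: "bounded_lipschitz X H"
    unfolding H_def diff_conv_add_uminus by (intro bounded_lipschitz_intros fL X)
  have qL: "bounded_lipschitz X (\<lambda>x. max 0 (1 - S x / m))"
  proof -
    have "bounded_lipschitz X (\<lambda>x. max 0 (1 + (-1 / m) * S x))"
      by (intro bounded_lipschitz_intros SL)
    then show ?thesis by simp
  qed
  have "\<eta> = (\<lambda>x. 1 + (-1) * (max 0 (1 - S x / m) * max 0 (1 - S x / m)))"
    by (simp add: fun_eq_iff \<eta>_def power2_eq_square)
  then have \<eta>L: "bounded_lipschitz X \<eta>"
    by (simp only:) (intro bounded_lipschitz_intros qL)
  have "G = (\<lambda>x. (-1) *\<^sub>R ((2 * max 0 (1 - S x / m)) *\<^sub>R ((- 1 / m) *\<^sub>R H x)))"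
    by (simp add: fun_eq_iff G_def)
  then have GL: "bounded_lipschitz X G"
    by (simp only:) (intro bounded_lipschitz_intros qL HL)
  show ?thesis
    by (rule that[OF der \<eta>1 _ _ \<eta>L GL]) (auto simp: \<eta>_def G_def S_off H_off)
qed

section \<open>Multiplication by a cutoff function\<close>

text \<open>
  As \<open>T\<close> need not be convex, \<open>h\<close> need not be Lipschitz on \<open>T\<close> with a constant
  controlled by its norm. But \<open>\<eta>\<close> vanishes off the compact set \<open>K\<close>, which has a distance \<open>d > 0\<close> from the
  complement of \<open>T\<close>: for two points at distance less than \<open>d\<close>, one of them in \<open>K\<close>, the
  mean value theorem applies on a ball inside \<open>T\<close>, and for points farther apart the Hoelder estimate
  follows from the bound on the differential. The estimates hold on the
  whole space; its convexity later turns the bound on the differential into a Lipschitz bound.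
\<close>

lemma cutoff_multiplication_bound:
  fixes T K X :: "'a::euclidean_space set" and \<eta> :: "'a \<Rightarrow> real" and G :: "'a \<Rightarrow> 'a"
  assumes T: "open T" "bounded T" "T \<noteq> {}" and K: "compact K" "K \<subseteq> T" and TX: "T \<subseteq> X"
    and \<alpha>: "0 \<le> \<alpha>" "\<alpha> \<le> 1"
    and der: "\<And>x. (\<eta> has_derivative (\<lambda>v. G x \<bullet> v)) (at x)"
    and off: "\<And>x. x \<notin> K \<Longrightarrow> \<eta> x = 0" "\<And>x. x \<notin> K \<Longrightarrow> G x = 0"
    and BL: "bounded_lipschitz X \<eta>" "bounded_lipschitz X G"
  shows "\<exists>C\<ge>0. \<forall>h :: 'a \<Rightarrow> 'b::euclidean_space. C1a_on \<alpha> T h \<longrightarrow> (\<exists>g'.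
      (\<forall>x. ((\<lambda>x. \<eta> x *\<^sub>R h x) has_derivative g' x) (at x)) \<and>
      (\<forall>x. norm (\<eta> x *\<^sub>R h x) \<le> C * C1a_norm \<alpha> T h) \<and>
      (\<forall>x v. norm (g' x v) \<le> C * C1a_norm \<alpha> T h * norm v) \<and>
      (\<forall>x y v. norm (g' x v - g' y v) \<le> C * C1a_norm \<alpha> T h * dist x y powr \<alpha> * norm v))"
proof -
  obtain B1 where B1: "0 \<le> B1" "\<And>x. x \<in> X \<Longrightarrow> norm (\<eta> x) \<le> B1"
    "\<And>x y. x \<in> X \<Longrightarrow> y \<in> X \<Longrightarrow> norm (\<eta> x - \<eta> y) \<le> B1 * dist x y"
    using bounded_lipschitzE[OF BL(1)] by metis
  obtain B2 where B2: "0 \<le> B2" "\<And>x. x \<in> X \<Longrightarrow> norm (G x) \<le> B2"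
    "\<And>x y. x \<in> X \<Longrightarrow> y \<in> X \<Longrightarrow> norm (G x - G y) \<le> B2 * dist x y"
    using bounded_lipschitzE[OF BL(2)] by metis
  define B where "B = max B1 B2"
  have B0: "0 \<le> B" using B1(1) by (simp add: B_def)
  have B: "norm (\<eta> x) \<le> B" "norm (G x) \<le> B" if "x \<in> T" for x
    using B1(2)[of x] B2(2)[of x] that TX by (auto simp: B_def)
  have BLip: "norm (\<eta> x - \<eta> y) \<le> B * dist x y" "norm (G x - G y) \<le> B * dist x y"
    if "x \<in> T" "y \<in> T" for x y
  proof -
    have "B1 * dist x y \<le> B * dist x y" "B2 * dist x y \<le> B * dist x y"
      by (auto simp: B_def intro!: mult_right_mono)
    then show "norm (\<eta> x - \<eta> y) \<le> B * dist x y" "norm (G x - G y) \<le> B * dist x y"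
      using B1(3)[of x y] B2(3)[of x y] that TX by (auto intro: order.trans)
  qed
  obtain d0 where d0: "0 < d0" "\<And>x y. x \<in> K \<Longrightarrow> y \<in> - T \<Longrightarrow> d0 \<le> dist x y"
  proof -
    have "K \<inter> - T = {}" "closed (- T)" using K T(1) by auto
    then show ?thesis
      using separate_compact_closed[OF K(1), of "- T"] that by blast
  qed
  \<comment> \<open>With \<open>d \<le> 1\<close>, distances below \<open>d\<close> are at most their \<open>\<alpha>\<close>-th powers.\<close>
  define d where "d = min 1 d0"
  have ballT: "ball x d \<subseteq> T" if "x \<in> K" for x
    using d0 that by (fastforce simp: d_def)+
  have dpos: "0 < d" "d \<le> 1" using d0 by (auto simp: d_def)
  \<comment> \<open>The product rule gives four terms, whose Hoelder constants near \<open>K\<close> are at most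
    \<open>B\<close> times the norm of \<open>h\<close>; the factor
    \<open>1 / d powr \<alpha>\<close> is for pairs of points at distance at least \<open>d\<close>.\<close>
  define C where "C = 4 * B / d powr \<alpha>"
  have dp: "0 < d powr \<alpha>" "d powr \<alpha> \<le> 1"
    using dpos \<alpha> by (auto simp: powr_le1)
  have C4: "4 * B \<le> C"
    unfolding C_def using dp B0 mult_left_mono[OF dp(2), of "4 * B"] by (simp add: le_divide_eq)
  then have C0: "0 \<le> C" using B0 by linarith
  have "\<exists>g'.
      (\<forall>x. ((\<lambda>x. \<eta> x *\<^sub>R h x) has_derivative g' x) (at x)) \<and>
      (\<forall>x. norm (\<eta> x *\<^sub>R h x) \<le> C * C1a_norm \<alpha> T h) \<and>
      (\<forall>x v. norm (g' x v) \<le> C * C1a_norm \<alpha> T h * norm v) \<and>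
      (\<forall>x y v. norm (g' x v - g' y v) \<le> C * C1a_norm \<alpha> T h * dist x y powr \<alpha> * norm v)"
    if h: "C1a_on \<alpha> T h" for h :: "'a \<Rightarrow> 'b"
  proof -
    define N where "N = C1a_norm \<alpha> T h"
    note hb = C1a_norm_bounds[OF T(2,1) \<alpha>(1) h, folded N_def]
    have N0: "0 \<le> N" using hb(4) T(3) by blast
    have N_lip: "norm (h x - h y) \<le> N * dist x y" if x: "x \<in> K" and y: "dist x y < d" for x y
    proof -
      have bT: "ball x d \<subseteq> T" by (rule ballT[OF x])
      have "norm (h x - h y) \<le> N * norm (x - y)"
      proof (rule differentiable_bound[of "ball x d" h "fderiv h"])
        show "(h has_derivative fderiv h z) (at z within ball x d)" if "z \<in> ball x d" for z
          using C1a_on_has_fderiv[OF h] that bT by (blast intro: has_derivative_at_withinI)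
        show "onorm (fderiv h z) \<le> N" if "z \<in> ball x d" for z
          using that bT by (intro onorm_bound N0 hb(2)) auto
      qed (use y dpos in auto)
      then show ?thesis by (simp add: dist_norm)
    qed
    define g' where "g' x v = (G x \<bullet> v) *\<^sub>R h x + \<eta> x *\<^sub>R fderiv h x v" for x v
    have g'_off: "g' x v = 0" if "x \<notin> K" for x v
      using off[OF that] by (simp add: g'_def)
    have g'_der: "((\<lambda>x. \<eta> x *\<^sub>R h x) has_derivative g' x) (at x)" for x
    proof (cases "x \<in> K")
      case True
      then have "x \<in> T" using K by blast
      from has_derivative_scaleR[OF der C1a_on_has_fderiv[OF h this]]
      show ?thesis by (simp add: g'_def[abs_def] add.commute)
    next
      case False
      have "((\<lambda>x. 0) has_derivative (\<lambda>v. 0)) (at x)" by simp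
      then have "((\<lambda>x. \<eta> x *\<^sub>R h x) has_derivative (\<lambda>v. 0)) (at x)"
        by (rule has_derivative_transform_within_open[where s = "- K"])
          (use False K(1) off in \<open>auto simp: compact_imp_closed open_Compl\<close>)
      moreover have "g' x = (\<lambda>v. 0)"
        using g'_off[OF False] by (simp add: fun_eq_iff)
      ultimately show ?thesis by simp
    qed
    have sup: "norm (\<eta> x *\<^sub>R h x) \<le> C * N" for x
    proof (cases "x \<in> K")
      case True
      then have x: "x \<in> T" using K by blast
      have "norm (\<eta> x *\<^sub>R h x) \<le> B * N"
        using B(1)[OF x] hb(1)[OF x] B0 by (simp add: mult_mono)
      also have "\<dots> \<le> C * N" using C4 B0 N0 by (intro mult_right_mono) auto
      finally show ?thesis .
    qed (simp add: off C0 N0)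
    have dersup: "norm (g' x v) \<le> 2 * B * N * norm v" for x v
    proof (cases "x \<in> K")
      case True
      then have x: "x \<in> T" using K by blast
      have "norm (g' x v) \<le> \<bar>G x \<bullet> v\<bar> * norm (h x) + \<bar>\<eta> x\<bar> * norm (fderiv h x v)"
        unfolding g'_def using norm_triangle_ineq by (metis norm_scaleR)
      also have "\<dots> \<le> (B * norm v) * N + B * (N * norm v)"
        using B[OF x] hb(1,2)[OF x] B0 N0
          order.trans[OF Cauchy_Schwarz_ineq2[of "G x" v] mult_right_mono[OF B(2)[OF x] norm_ge_zero]]
        by (intro add_mono mult_mono) auto
      finally show ?thesis by (simp add: algebra_simps)
    qed (simp add: g'_off B0 N0)
    \<comment> \<open>Near \<open>K\<close> the segment from \<open>x\<close> to \<open>y\<close> lies in \<open>T\<close>, so that \<open>h\<close> is Lipschitz along it.\<close>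
    have near: "norm (g' x v - g' y v) \<le> 4 * B * N * dist x y powr \<alpha> * norm v"
      if x: "x \<in> K" and y: "dist x y < d" for x y v
    proof -
      have xT: "x \<in> T" and yT: "y \<in> T"
        using K x ballT[OF x] y by auto
      define \<delta> where "\<delta> = dist x y powr \<alpha>"
      have le: "dist x y \<le> \<delta>"
        using powr_mono'[of \<alpha> 1 "dist x y"] \<alpha> y dpos by (simp add: \<delta>_def)
      have \<delta>0: "0 \<le> \<delta>" by (simp add: \<delta>_def)
      have eq: "g' x v - g' y v = ((G x - G y) \<bullet> v) *\<^sub>R h x + (G y \<bullet> v) *\<^sub>R (h x - h y)
          + ((\<eta> x - \<eta> y) *\<^sub>R fderiv h x v + \<eta> y *\<^sub>R (fderiv h x v - fderiv h y v))"
        by (simp add: g'_def algebra_simps inner_diff_left)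
      have "norm (g' x v - g' y v) \<le> \<bar>(G x - G y) \<bullet> v\<bar> * norm (h x) + \<bar>G y \<bullet> v\<bar> * norm (h x - h y)
          + (\<bar>\<eta> x - \<eta> y\<bar> * norm (fderiv h x v) + \<bar>\<eta> y\<bar> * norm (fderiv h x v - fderiv h y v))"
        unfolding eq by (intro norm_triangle_mono) (auto simp: norm_scaleR)
      also have "\<dots> \<le> (B * \<delta> * norm v) * N + (B * norm v) * (N * \<delta>)
          + ((B * \<delta>) * (N * norm v) + B * (N * \<delta> * norm v))"
      proof (intro add_mono mult_mono)
        have "norm (G x - G y) \<le> B * \<delta>"
          using order.trans[OF BLip(2)[OF xT yT] mult_left_mono[OF le B0]] .
        then show "\<bar>(G x - G y) \<bullet> v\<bar> \<le> B * \<delta> * norm v"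
          using order.trans[OF Cauchy_Schwarz_ineq2 mult_right_mono[OF _ norm_ge_zero]] by blast
        show "\<bar>G y \<bullet> v\<bar> \<le> B * norm v"
          using order.trans[OF Cauchy_Schwarz_ineq2 mult_right_mono[OF B(2)[OF yT] norm_ge_zero]] .
        show "norm (h x - h y) \<le> N * \<delta>"
          using order.trans[OF N_lip[OF x y] mult_left_mono[OF le N0]] .
        show "\<bar>\<eta> x - \<eta> y\<bar> \<le> B * \<delta>"
          using order.trans[OF BLip(1)[OF xT yT] mult_left_mono[OF le B0]] by simp
        show "norm (fderiv h x v - fderiv h y v) \<le> N * \<delta> * norm v"
          unfolding \<delta>_def by (rule hb(3)[OF xT yT])
        show "\<bar>\<eta> y\<bar> \<le> B" using B(1)[OF yT] by simp
      qed (use hb(1,2)[OF xT] B0 N0 \<delta>0 in auto)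
      finally show ?thesis by (simp add: algebra_simps \<delta>_def)
    qed
    have hoelder: "norm (g' x v - g' y v) \<le> C * N * dist x y powr \<alpha> * norm v" for x y v
    proof (cases "dist x y < d")
      case True
      have "norm (g' x v - g' y v) \<le> 4 * B * N * dist x y powr \<alpha> * norm v"
        using near[of x y v] near[of y x v] True B0 N0
        by (cases "x \<in> K"; cases "y \<in> K") (auto simp: dist_commute norm_minus_commute g'_off)
      also have "\<dots> \<le> C * N * dist x y powr \<alpha> * norm v"
        using C4 N0 by (intro mult_right_mono) auto
      finally show ?thesis .
    next
      case False
      have "norm (g' x v - g' y v) \<le> norm (g' x v) + norm (g' y v)"
        by (rule norm_triangle_ineq4)
      also have "\<dots> \<le> 4 * B * N * norm v"
        using dersup[of x v] dersup[of y v] by simp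
      also have "\<dots> = C * N * d powr \<alpha> * norm v"
        using dp by (simp add: C_def)
      also have "\<dots> \<le> C * N * dist x y powr \<alpha> * norm v"
        using False dpos \<alpha> C0 N0 by (intro mult_right_mono mult_left_mono powr_mono2) auto
      finally show ?thesis .
    qed
    have "2 * B * N * norm v \<le> C * N * norm v" for v :: 'a
      using C4 B0 N0 by (intro mult_right_mono) auto
    then have "norm (g' x v) \<le> C * N * norm v" for x v
      using dersup order.trans by blast
    then show ?thesis
      using g'_der sup hoelder unfolding N_def by (intro exI[of _ g']) blast
  qed
  then show ?thesis
    using C0 by blast
qed

section \<open>Perturbations of the identity\<close>

text \<open>
  Solving \<open>x + g x = y\<close> amounts to finding a fixed point of the contraction that sends \<open>x\<close>
  to \<open>y - g x\<close>.
\<close>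

lemma id_plus_contraction_bij:
  fixes g :: "'a::{real_normed_vector, complete_space} \<Rightarrow> 'a"
  assumes g: "\<And>x y. norm (g x - g y) \<le> 1/2 * norm (x - y)"
  shows "bij (\<lambda>x. x + g x)"
    and id_plus_contraction_expands: "norm (x - y) \<le> 2 * norm ((x + g x) - (y + g y))"
proof -
  show *: "norm (x - y) \<le> 2 * norm ((x + g x) - (y + g y))" for x y
  proof -
    have "norm (x - y) = norm (((x + g x) - (y + g y)) - (g x - g y))"
      by (simp add: algebra_simps)
    also have "\<dots> \<le> norm ((x + g x) - (y + g y)) + 1/2 * norm (x - y)"
      using norm_triangle_ineq4[of "(x + g x) - (y + g y)" "g x - g y"] g[of x y] by linarith
    finally show ?thesis by simp
  qed
  have "\<exists>x. x + g x = y" for y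
  proof -
    have "\<exists>!x. y - g x = x"
      by (rule banach_fix_type[of "1/2"])
        (use g in \<open>auto simp: dist_norm norm_minus_commute\<close>)
    then obtain x where "y - g x = x" by blast
    then show ?thesis by (metis diff_add_cancel)
  qed
  moreover have "inj (\<lambda>x. x + g x)"
    using * by (intro injI) (metis diff_self mult_zero_right norm_zero norm_le_zero_iff right_minus_eq)
  ultimately show "bij (\<lambda>x. x + g x)"
    by (metis bij_def surjI surj_def)
qed

text \<open>
  The complement of \<open>S\<close> is fixed pointwise, so it is mapped onto itself, and bijectivity leaves \<open>S\<close> as
  the image of \<open>S\<close>.
\<close>

lemma image_eq_if_identity_off_subset:
  assumes "bij F" "\<And>x. x \<notin> K \<Longrightarrow> F x = x" "K \<subseteq> S"
  shows "F ` S = S"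
proof -
  have "F ` (- S) = - S"
    using assms(2,3) by force
  moreover have "F ` (- S) = - F ` S"
    using assms(1) by (rule bij_image_Compl_eq)
  ultimately show ?thesis by blast
qed

lemma id_plus_contraction_inverse_deriv:
  fixes g :: "'a::euclidean_space \<Rightarrow> 'a"
  assumes der: "\<And>x. (g has_derivative g' x) (at x)"
    and half: "\<And>x v. norm (g' x v) \<le> 1/2 * norm v"
    and hoelder: "\<And>x y v. norm (g' x v - g' y v) \<le> c * dist x y powr \<alpha> * norm v"
    and \<alpha>: "0 \<le> \<alpha>"
  defines "F \<equiv> \<lambda>x. x + g x"
  obtains H where "\<forall>y. (inv F has_derivative H y) (at y)" "\<forall>y. bounded_linear (H y)"
    "\<forall>x y w. norm (H x w - H y w) \<le> 4 * \<bar>c\<bar> * 2 powr \<alpha> * dist x y powr \<alpha> * norm w"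
proof -
  have lip: "norm (g x - g y) \<le> 1/2 * norm (x - y)" for x y
  proof (rule differentiable_bound[of UNIV g g'])
    show "onorm (g' z) \<le> 1/2" for z
      by (rule onorm_bound) (use half in auto)
  qed (use der in auto)
  note bij = id_plus_contraction_bij[OF lip, folded F_def]
    and expand = id_plus_contraction_expands[OF lip]
  have FG: "F (inv F y) = y" for y
    using bij by (simp add: bij_is_surj surj_f_inv_f)
  have Glip: "dist (inv F x) (inv F y) \<le> 2 * dist x y" for x y
    using expand[of "inv F x" "inv F y"] FG[of x] FG[of y] by (simp add: F_def dist_norm)
  have Gcont: "continuous (at y) (inv F)" for y
  proof -
    have "2-lipschitz_on UNIV (inv F)"
      using Glip by (intro lipschitz_onI) auto
    then show ?thesis
      using lipschitz_on_continuous_on continuous_on_eq_continuous_at[OF open_UNIV] by blast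
  qed
  have lin: "linear (g' x)" for x
    using der[of x] has_derivative_linear by blast
  \<comment> \<open>The differential \<open>P x\<close> of \<open>F\<close> is again a contraction added to the identity, hence invertible
    with inverse of norm at most \<open>2\<close>.\<close>
  define P where "P x v = v + g' x v" for x v
  have Plin: "linear (P x)" for x
    unfolding P_def[abs_def] by (intro linear_compose_add linear_ident lin)
  have Pexpand: "norm v \<le> 2 * norm (P x v)" for x v
    using id_plus_contraction_expands[of "g' x" v 0] half[of x] lin[of x]
    by (simp add: P_def linear_0 flip: linear_diff)
  have "inj (P x)" for x
  proof (subst linear_injective_0[OF Plin], intro allI impI)
    show "v = 0" if "P x v = 0" for v
      using Pexpand[of v x] that by simp
  qed
  then have Pbij: "bij (P x)" for x
    using linear_injective_imp_surjective[OF Plin] by (simp add: bij_def)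
  define H where "H y = inv (P (inv F y))" for y
  have PH: "P (inv F y) (H y w) = w" for y w
    using Pbij by (simp add: H_def bij_is_surj surj_f_inv_f)
  have HP: "H y (P (inv F y) v) = v" for y v
    using Pbij by (simp add: H_def bij_is_inj inv_f_f)
  have Hnorm: "norm (H y w) \<le> 2 * norm w" for y w
    using Pexpand[of "H y w" "inv F y"] PH by simp
  have Hlin: "linear (H y)" for y
  proof (rule linearI)
    show "H y (a + b) = H y a + H y b" for a b
      using HP[of y "H y a + H y b"] by (simp add: linear_add[OF Plin] PH)
    show "H y (r *\<^sub>R b) = r *\<^sub>R H y b" for r b
      using HP[of y "r *\<^sub>R H y b"] by (simp add: linear_scale[OF Plin] PH)
  qed
  have 1: "(inv F has_derivative H y) (at y)" for y
  proof (rule has_derivative_inverse_basic[where T = UNIV and f = F and f' = "P (inv F y)"])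
    show "(F has_derivative P (inv F y)) (at (inv F y))"
      unfolding F_def P_def[abs_def] by (intro has_derivative_add has_derivative_ident der)
    show "bounded_linear (H y)" using Hlin by (rule linear_conv_bounded_linear[THEN iffD1])
    show "H y \<circ> P (inv F y) = id" using HP by auto
  qed (use Gcont FG in auto)
  have 2: "bounded_linear (H y)" for y
    using Hlin by (rule linear_conv_bounded_linear[THEN iffD1])
  \<comment> \<open>The resolvent identity \<open>P\<^sup>-\<^sup>1 - Q\<^sup>-\<^sup>1 = P\<^sup>-\<^sup>1 (Q - P) Q\<^sup>-\<^sup>1\<close>, together with
    \<open>\<parallel>P\<^sup>-\<^sup>1\<parallel>, \<parallel>Q\<^sup>-\<^sup>1\<parallel> \<le> 2\<close>.\<close>
  have 3: "norm (H x w - H y w) \<le> 4 * \<bar>c\<bar> * 2 powr \<alpha> * dist x y powr \<alpha> * norm w" for x y w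
  proof -
    have "P (inv F x) (H x w - H y w) = P (inv F y) (H y w) - P (inv F x) (H y w)"
      by (simp only: linear_diff[OF Plin] PH)
    also have "\<dots> = g' (inv F y) (H y w) - g' (inv F x) (H y w)"
      by (simp add: P_def)
    finally have "P (inv F x) (H x w - H y w) = g' (inv F y) (H y w) - g' (inv F x) (H y w)" .
    then have "norm (H x w - H y w) \<le> 2 * norm (g' (inv F y) (H y w) - g' (inv F x) (H y w))"
      using Pexpand[of "H x w - H y w" "inv F x"] by simp
    also have "\<dots> \<le> 2 * (c * dist (inv F y) (inv F x) powr \<alpha> * norm (H y w))"
      using hoelder by (intro mult_left_mono) auto
    also have "\<dots> \<le> 2 * (\<bar>c\<bar> * (2 * dist x y) powr \<alpha> * (2 * norm w))"
      using Glip[of x y] \<alpha> Hnorm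
      by (intro mult_left_mono mult_mono powr_mono2) (auto simp: dist_commute)
    also have "\<dots> = 4 * \<bar>c\<bar> * 2 powr \<alpha> * dist x y powr \<alpha> * norm w"
      by (simp add: powr_mult)
    finally show ?thesis .
  qed
  show ?thesis using that 1 2 3 by blast
qed

lemma C1a_diffeo_id_plus:
  fixes g :: "'a::euclidean_space \<Rightarrow> 'a"
  assumes der: "\<And>x. (g has_derivative g' x) (at x)"
    and half: "\<And>x v. norm (g' x v) \<le> 1/2 * norm v"
    and hoelder: "\<And>x y v. norm (g' x v - g' y v) \<le> c * dist x y powr \<alpha> * norm v"
    and \<alpha>: "0 \<le> \<alpha>"
    and supp: "\<And>x. x \<notin> K \<Longrightarrow> g x = 0" "K \<subseteq> U" and U: "open U"
    and f: "\<And>x. x \<in> closure U \<Longrightarrow> f x = x + g x"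
  shows "C1a_diffeo \<alpha> U U f"
    and "homeomorphism UNIV UNIV (\<lambda>x. x + g x) (inv (\<lambda>x. x + g x))"
    and "(\<lambda>x. x + g x) ` U = U"
proof -
  define F where "F x = x + g x" for x
  have F_eq: "F = (\<lambda>x. x + g x)" by (simp add: F_def fun_eq_iff)
  have lip: "norm (g x - g y) \<le> 1/2 * norm (x - y)" for x y
  proof (rule differentiable_bound[of UNIV g g'])
    show "onorm (g' z) \<le> 1/2" for z
      by (rule onorm_bound) (use half in auto)
  qed (use der in auto)
  have bij: "bij F"
    using id_plus_contraction_bij[OF lip] by (simp add: F_eq)
  have cl: "K \<subseteq> closure U" using supp(2) closure_subset by blast
  have img: "F ` U = U" "F ` closure U = closure U"
    by (rule image_eq_if_identity_off_subset[OF bij _ supp(2)], simp add: F_def supp(1))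
      (rule image_eq_if_identity_off_subset[OF bij _ cl], simp add: F_def supp(1))
  then show "(\<lambda>x. x + g x) ` U = U" by (simp add: F_eq)
  obtain H where H: "\<forall>y. (inv F has_derivative H y) (at y)" "\<forall>y. bounded_linear (H y)"
    "\<forall>x y w. norm (H x w - H y w) \<le> 4 * \<bar>c\<bar> * 2 powr \<alpha> * dist x y powr \<alpha> * norm w"
    unfolding F_eq by (rule id_plus_contraction_inverse_deriv[OF der half hoelder \<alpha>])
  have Fder: "(F has_derivative (\<lambda>v. v + g' x v)) (at x)" for x
    unfolding F_eq by (intro has_derivative_add has_derivative_ident der)
  have Fcont: "continuous_on S F" for S
    by (intro continuous_at_imp_continuous_on ballI has_derivative_continuous[OF Fder])
  have Gcont: "continuous_on S (inv F)" for S
    by (intro continuous_at_imp_continuous_on ballI has_derivative_continuous[OF H(1)[rule_format]])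
  have "homeomorphism UNIV UNIV F (inv F)"
    using bij Fcont Gcont
    by (auto simp: homeomorphism_def bij_is_surj surj_f_inv_f bij_is_inj inj_imp_surj_inv)
  then show "homeomorphism UNIV UNIV (\<lambda>x. x + g x) (inv (\<lambda>x. x + g x))"
    by (simp add: F_eq)
  have "C1a_on \<alpha> U F"
    by (rule C1a_onI[OF Fcont Fder has_derivative_bounded_linear[OF Fder]])
      (use hoelder in \<open>simp add: algebra_simps\<close>)
  then have 1: "C1a_on \<alpha> U f"
    by (rule C1a_on_cong[OF U]) (simp add: f F_def)
  have bijf: "bij_betw f (closure U) (closure U)"
  proof -
    have "bij_betw F (closure U) (closure U)"
      using bij img(2) by (metis bij_betw_def bij_def inj_on_subset subset_UNIV)
    then show ?thesis
      using f by (simp cong: bij_betw_cong add: F_def)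
  qed
  have "C1a_on \<alpha> U (inv F)"
    by (rule C1a_onI[OF Gcont H[rule_format]])
  then have 2: "C1a_on \<alpha> U (inv_into (closure U) f)"
  proof (rule C1a_on_cong[OF U])
    fix y assume y: "y \<in> closure U"
    then obtain x where x: "x \<in> closure U" "y = F x"
      using img(2) by blast
    have "inv_into (closure U) f (f x) = x"
      using bijf x(1) by (meson bij_betw_imp_inj_on inv_into_f_f)
    then show "inv_into (closure U) f y = inv F y"
      using x f bij by (simp add: F_def[symmetric] bij_is_inj inv_f_f)
  qed
  show "C1a_diffeo \<alpha> U U f"
    unfolding C1a_diffeo_def using bijf 1 2 by blast
qed

section \<open>Domains bounded by the image of a hypersurface\<close>

text \<open>
  Off its frontier, the space splits into \<open>S\<close>, which is connected and bounded, and the exterior of \<open>S\<close>,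
  which is connected and unbounded.
\<close>

lemma inside_frontier_open:
  fixes S :: "'a::euclidean_space set"
  assumes S: "open S" "bounded S" "connected S" "connected (- closure S)"
  shows "inside (frontier S) = S"
proof
  show "S \<subseteq> inside (frontier S)"
  proof
    fix x assume x: "x \<in> S"
    have fr: "S \<inter> frontier S = {}"
      using S(1) by (auto simp: frontier_def interior_open)
    let ?C = "connected_component_set (- frontier S) x"
    have "?C \<subseteq> S"
    proof (rule ccontr)
      assume "\<not> ?C \<subseteq> S"
      moreover have "?C \<inter> S \<noteq> {}"
        using x fr connected_component_refl[of x "- frontier S"] by blast
      ultimately have "?C \<inter> frontier S \<noteq> {}"
        by (intro connected_Int_frontier connected_connected_component) auto
      then show False
        using connected_component_subset[of "- frontier S" x] by blast
    qed
    then show "x \<in> inside (frontier S)"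
      using S(2) x fr bounded_subset by (auto simp: inside_def)
  qed
  show "inside (frontier S) \<subseteq> S"
  proof
    fix x assume x: "x \<in> inside (frontier S)"
    show "x \<in> S"
    proof (rule ccontr)
      assume "x \<notin> S"
      moreover have "x \<notin> frontier S" using x by (auto simp: inside_def)
      ultimately have "x \<in> - closure S"
        using S(1) by (auto simp: frontier_def interior_open)
      then have "- closure S \<subseteq> connected_component_set (- frontier S) x"
        by (intro connected_component_maximal S(4)) (auto simp: frontier_def)
      then have "bounded (- closure S)"
        using x bounded_subset by (auto simp: inside_def)
      moreover have "\<not> bounded (- closure S)"
        using bounded_closure[OF S(2)] by (intro cobounded_imp_unbounded) simp
      ultimately show False by blast
    qed
  qed
qed

text \<open>
  A homeomorphism of the whole space preserves each hypothesis of the preceding lemma, which can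
  therefore be applied to the image of \<open>S\<close>.
\<close>

lemma inside_homeomorphic_image_frontier:
  fixes S :: "'a::euclidean_space set" and F F' :: "'a \<Rightarrow> 'a"
  assumes F: "homeomorphism UNIV UNIV F F'"
    and S: "open S" "bounded S" "connected S" "connected (- closure S)"
  shows "inside (F ` frontier S) = F ` S" and "closure (F ` S) = F ` closure S"
proof -
  have F'F: "F' (F x) = x" and FF': "F (F' y) = y" for x y
    using F by (auto simp: homeomorphism_def)
  have cont: "continuous_on X F" "continuous_on X F'" for X
    using F continuous_on_subset by (auto simp: homeomorphism_def)
  have op: "open (F ` X)" if "open X" for X
    using homeomorphism_imp_open_map[OF F, of X] that by simp
  have bij: "bij F"
    using F'F FF' by (metis bij_betw_def bij_def injI surjI)
  have cmp: "compact (closure S)" using bounded_closure[OF S(2)] by (simp add: compact_eq_bounded_closed)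
  show cl: "closure (F ` S) = F ` closure S"
  proof
    have "closed (F ` closure S)"
      using cont cmp by (simp add: compact_continuous_image compact_imp_closed)
    then show "closure (F ` S) \<subseteq> F ` closure S"
      using closure_subset by (intro closure_minimal image_mono)
    show "F ` closure S \<subseteq> closure (F ` S)"
      by (rule image_closure_subset[OF cont(1)]) (auto simp: closure_subset)
  qed
  have "frontier (F ` S) = F ` frontier S"
    using bij S(1) op[OF S(1)]
    by (simp add: frontier_def cl interior_open image_set_diff bij_is_inj)
  moreover have "inside (frontier (F ` S)) = F ` S"
  proof (rule inside_frontier_open[OF op[OF S(1)]])
    show "bounded (F ` S)"
      using cl compact_continuous_image[OF cont(1) cmp]
      by (metis bounded_subset closure_subset compact_imp_bounded)
    show "connected (F ` S)"
      using S(3) cont by (intro connected_continuous_image)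
    have "- closure (F ` S) = F ` (- closure S)"
      using bij by (simp add: cl bij_image_Compl_eq)
    then show "connected (- closure (F ` S))"
      using S(4) cont by (simp add: connected_continuous_image)
  qed
  ultimately show "inside (F ` frontier S) = F ` S" by simp
qed

section \<open>Tubes\<close>

lemma tube_facts:
  fixes \<Omega> :: "'a::euclidean_space set"
  assumes tub: "is_tubular_data \<alpha> \<Omega> \<omega> \<delta>0" and \<delta>: "0 < \<delta>" "\<delta> < \<delta>0"
  shows open_tube: "open (tube \<Omega> \<omega> \<delta>)"
    and bounded_tube: "bounded \<Omega> \<Longrightarrow> bounded (tube \<Omega> \<omega> \<delta>)"
    and closure_tube_subset: "\<delta> < \<delta>' \<Longrightarrow> closure (tube \<Omega> \<omega> \<delta>) \<subseteq> tube \<Omega> \<omega> \<delta>'"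
    and frontier_subset_tube: "frontier \<Omega> \<subseteq> tube \<Omega> \<omega> \<delta>"
proof -
  have \<omega>: "norm (\<omega> x) = 1" if "x \<in> frontier \<Omega>" for x
    using tub that by (simp add: is_tubular_data_def)
  have fr: "open (tube \<Omega> \<omega> \<delta>)" "frontier (tube \<Omega> \<omega> \<delta>) = layer \<Omega> \<omega> {-\<delta>, \<delta>}"
    using tub \<delta> by (simp_all add: is_tubular_data_def)
  show "open (tube \<Omega> \<omega> \<delta>)" by (rule fr)
  show "closure (tube \<Omega> \<omega> \<delta>) \<subseteq> tube \<Omega> \<omega> \<delta>'" if "\<delta> < \<delta>'"
  proof -
    have "closure (tube \<Omega> \<omega> \<delta>) = tube \<Omega> \<omega> \<delta> \<union> layer \<Omega> \<omega> {-\<delta>, \<delta>}"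
      by (metis closure_Un_frontier fr(2))
    also have "\<dots> \<subseteq> tube \<Omega> \<omega> \<delta>'"
      using \<delta> that by (fastforce simp: layer_def)
    finally show ?thesis .
  qed
  show "frontier \<Omega> \<subseteq> tube \<Omega> \<omega> \<delta>"
    using \<delta> by (force simp: layer_def)
  show "bounded (tube \<Omega> \<omega> \<delta>)" if bd: "bounded \<Omega>"
  proof -
    obtain B where B: "\<And>x. x \<in> frontier \<Omega> \<Longrightarrow> norm x \<le> B"
      using compact_imp_bounded[OF compact_frontier_bounded[OF bd]] by (auto simp: bounded_iff)
    show ?thesis
    proof (rule boundedI)
      fix y assume "y \<in> tube \<Omega> \<omega> \<delta>"
      then obtain x s where y: "y = x + s *\<^sub>R \<omega> x" "x \<in> frontier \<Omega>" "\<bar>s\<bar> < \<delta>"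
        by (auto simp: layer_def)
      then show "norm y \<le> B + \<delta>"
        using norm_triangle_ineq[of x "s *\<^sub>R \<omega> x"] B[of x] \<omega>[of x] by simp
    qed
  qed
qed

section \<open>Extension of boundary diffeomorphisms\<close>

theorem lemma3p1:
  fixes \<Omega>o \<Omega>i :: "(real ^ 'n) set"
    and \<alpha> \<delta>\<Omega>i \<delta>t :: real
    and \<C> :: "(real ^ 'n) boundary_chart set"
    and \<omega> :: "real ^ 'n \<Rightarrow> real ^ 'n"
    and \<W>t :: "(real ^ 'n \<Rightarrow> real ^ 'n) set"
    and E :: "(real ^ 'n \<Rightarrow> real ^ 'n) \<Rightarrow> (real ^ 'n \<Rightarrow> real ^ 'n)"
    and \<phi>0 :: "real ^ 'n \<Rightarrow> real ^ 'n"
  assumes n_ge_2: "CARD('n) \<ge> 2"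
    and alpha: "0 < \<alpha>" "\<alpha> < 1"
    and Omega_o: "C1a_open_set \<alpha> \<Omega>o" "bounded \<Omega>o" "connected \<Omega>o" "connected (- closure \<Omega>o)"
    and Omega_i: "C1a_open_set \<alpha> \<Omega>i" "bounded \<Omega>i" "connected \<Omega>i" "connected (- closure \<Omega>i)"
      "\<Omega>i \<noteq> {}"
    and inclusion: "closure \<Omega>i \<subseteq> \<Omega>o"
    and atlas: "is_finite_atlas \<alpha> \<Omega>i \<C>"
    and phi0: "\<phi>0 = restrict_zero (frontier \<Omega>i) id"
    and tubular: "is_tubular_data \<alpha> \<Omega>i \<omega> \<delta>\<Omega>i"
    and delta_tilde: "0 < \<delta>t" "\<delta>t < \<delta>\<Omega>i"
    and W_tilde: "relatively_open (C1a_boundary_norm \<alpha> \<C>) (boundary_diffeos_in \<alpha> \<Omega>o \<Omega>i) \<W>t"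
      "\<phi>0 \<in> \<W>t"
    and E_analytic: "real_analytic_map
      (C1a_boundary_space \<alpha> \<Omega>i) (C1a_boundary_norm \<alpha> \<C>)
      (C1a_space \<alpha> (tube \<Omega>i \<omega> \<delta>t)) (C1a_norm \<alpha> (tube \<Omega>i \<omega> \<delta>t))
      (C1a_boundary_space \<alpha> \<Omega>i) E"
    and E_diffeo: "E ` \<W>t \<subseteq> tube_diffeos \<alpha> \<Omega>i \<omega> \<delta>t"
    and E_extends: "\<And>\<phi> x. \<phi> \<in> \<W>t \<Longrightarrow> x \<in> frontier \<Omega>i \<Longrightarrow> E \<phi> x = \<phi> x"
    and E_range: "\<And>\<phi>. \<phi> \<in> \<W>t \<Longrightarrow> E \<phi> ` closure (tube \<Omega>i \<omega> \<delta>t) \<subseteq> \<Omega>o"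
    and E_phi0: "E \<phi>0 = restrict_zero (closure (tube \<Omega>i \<omega> \<delta>t)) id"
  shows "\<exists>(\<W> :: (real ^ 'n \<Rightarrow> real ^ 'n) set) (\<rho>1 :: real) (\<rho>2 :: real)
      (\<Psi> :: (real ^ 'n \<Rightarrow> real ^ 'n) \<Rightarrow> (real ^ 'n \<Rightarrow> real ^ 'n)).
      relatively_open (C1a_boundary_norm \<alpha> \<C>) (boundary_diffeos_in \<alpha> \<Omega>o \<Omega>i) \<W> \<and>
      \<phi>0 \<in> \<W> \<and> \<W> \<subseteq> \<W>t \<and>
      0 < \<rho>1 \<and> \<rho>1 < \<rho>2 \<and> \<rho>2 < \<delta>t \<and> \<delta>t < \<delta>\<Omega>i \<and>
      real_analytic_map
        (C1a_boundary_space \<alpha> \<Omega>i) (C1a_boundary_norm \<alpha> \<C>)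
        (C1a_space \<alpha> \<Omega>o) (C1a_norm \<alpha> \<Omega>o) \<W> \<Psi> \<and>
      (\<forall>\<phi>\<in>\<W>. C1a_diffeo \<alpha> \<Omega>o \<Omega>o (\<Psi> \<phi>)) \<and>
      (\<forall>\<phi>\<in>\<W>.
        (\<forall>x\<in>closure (tube \<Omega>i \<omega> \<rho>1). \<Psi> \<phi> x = E \<phi> x) \<and>
        (\<forall>x\<in>closure \<Omega>o - tube \<Omega>i \<omega> \<rho>2. \<Psi> \<phi> x = x)) \<and>
      (\<forall>\<phi>\<in>\<W>.
        \<Psi> \<phi> ` \<Omega>i = enclosed_domain \<Omega>i \<phi> \<and>
        \<Psi> \<phi> ` (\<Omega>o - closure \<Omega>i) = \<Omega>o - closure (enclosed_domain \<Omega>i \<phi>))"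
proof -
  have \<alpha>: "0 \<le> \<alpha>" "\<alpha> \<le> 1" using alpha by auto
  have open_o: "open \<Omega>o" and open_i: "open \<Omega>i"
    using Omega_o(1) Omega_i(1) by (auto simp: C1a_open_set_def)
  define \<rho>1 where "\<rho>1 = \<delta>t / 4"
  define \<rho>2 where "\<rho>2 = \<delta>t / 2"
  have \<rho>: "0 < \<rho>1" "\<rho>1 < \<rho>2" "\<rho>2 < \<delta>t" "0 < \<rho>2" "\<rho>1 < \<delta>\<Omega>i" "\<rho>2 < \<delta>\<Omega>i"
    using delta_tilde by (auto simp: \<rho>1_def \<rho>2_def)
  define T where "T = tube \<Omega>i \<omega> \<delta>t"
  define V where "V = tube \<Omega>i \<omega> \<rho>2"
  define K where "K = closure V"
  define A where "A = closure (tube \<Omega>i \<omega> \<rho>1)"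
  note tube_\<delta>t = tube_facts[OF tubular delta_tilde, folded T_def]
    and tube_\<rho>2 = tube_facts[OF tubular \<rho>(4,6), folded V_def]
    and tube_\<rho>1 = tube_facts[OF tubular \<rho>(1,5)]
  have T: "open T" "bounded T"
    using tube_\<delta>t(1,2) Omega_i(2) by auto
  have "\<Omega>i \<noteq> UNIV" using Omega_i(2) by auto
  then have "frontier \<Omega>i \<noteq> {}"
    using Omega_i(5) by (simp add: frontier_eq_empty)
  then have T_ne: "T \<noteq> {}" using tube_\<delta>t(4) by blast
  have K: "compact K" "K \<subseteq> T" "V \<subseteq> K"
    using bounded_closure[OF tube_\<rho>2(2)[OF Omega_i(2)]] tube_\<rho>2(3)[OF \<rho>(3)] closure_subset
    by (auto simp: K_def compact_eq_bounded_closed T_def)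
  have A: "compact A" "A \<subseteq> V"
    using bounded_closure[OF tube_\<rho>1(2)[OF Omega_i(2)]] tube_\<rho>1(3)[OF \<rho>(2)]
    by (auto simp: A_def compact_eq_bounded_closed V_def)
  have E\<phi>0: "E \<phi>0 x = x" if "x \<in> closure T" for x
    using E_phi0 that by (simp add: restrict_zero_def T_def)
  have clT: "closure T \<subseteq> \<Omega>o"
    using E_range[OF W_tilde(2), folded T_def] E\<phi>0 by force
  have T_o: "T \<subseteq> \<Omega>o" using clT closure_subset by blast
  then have K_o: "K \<subseteq> \<Omega>o" using K by blast
  have o_ne: "\<Omega>o \<noteq> {}" using T_o T_ne by blast

  obtain \<eta> :: "real ^ 'n \<Rightarrow> real" and G :: "real ^ 'n \<Rightarrow> real ^ 'n"
    where \<eta>: "\<forall>x. (\<eta> has_derivative (\<lambda>v. G x \<bullet> v)) (at x)"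
      and \<eta>1: "\<forall>x. x \<in> A \<longrightarrow> \<eta> x = 1"
      and \<eta>0: "\<forall>x. x \<notin> V \<longrightarrow> \<eta> x = 0" and G0: "\<forall>x. x \<notin> V \<longrightarrow> G x = 0"
      and \<eta>L: "bounded_lipschitz T \<eta>" "bounded_lipschitz T G"
    using C11_cutoff_exists[OF A tube_\<rho>2(1) T(2)] by metis
  define L where "L = (\<lambda>(h :: real ^ 'n \<Rightarrow> real ^ 'n) x. \<eta> x *\<^sub>R h x)"
  have "\<exists>C\<ge>0. \<forall>h :: real ^ 'n \<Rightarrow> real ^ 'n. C1a_on \<alpha> T h \<longrightarrow> (\<exists>g'.
      (\<forall>x. (L h has_derivative g' x) (at x)) \<and>
      (\<forall>x. norm (L h x) \<le> C * C1a_norm \<alpha> T h) \<and>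
      (\<forall>x v. norm (g' x v) \<le> C * C1a_norm \<alpha> T h * norm v) \<and>
      (\<forall>x y v. norm (g' x v - g' y v) \<le> C * C1a_norm \<alpha> T h * dist x y powr \<alpha> * norm v))"
    unfolding L_def
    by (rule cutoff_multiplication_bound[OF T T_ne K(1,2) order_refl \<alpha> \<eta>[rule_format] _ _ \<eta>L,
          where 'b = "real ^ 'n"])
      (use \<eta>0 G0 K(3) in auto)
  then obtain C where C0: "0 \<le> C" and C: "\<And>h :: real ^ 'n \<Rightarrow> real ^ 'n. C1a_on \<alpha> T h \<Longrightarrow> \<exists>g'.
      (\<forall>x. (L h has_derivative g' x) (at x)) \<and>
      (\<forall>x. norm (L h x) \<le> C * C1a_norm \<alpha> T h) \<and>
      (\<forall>x v. norm (g' x v) \<le> C * C1a_norm \<alpha> T h * norm v) \<and>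
      (\<forall>x y v. norm (g' x v - g' y v) \<le> C * C1a_norm \<alpha> T h * dist x y powr \<alpha> * norm v)"
    by auto
  have L_off: "L h x = 0" if "x \<notin> V" for h x
    using \<eta>0 that by (simp add: L_def)

  define X :: "(real ^ 'n \<Rightarrow> real ^ 'n) set" where "X = C1a_boundary_space \<alpha> \<Omega>i"
  define Y :: "(real ^ 'n \<Rightarrow> real ^ 'n) set" where "Y = C1a_space \<alpha> T"
  define Z :: "(real ^ 'n \<Rightarrow> real ^ 'n) set" where "Z = C1a_space \<alpha> \<Omega>o"
  have semi_X: "seminorm_on X (C1a_boundary_norm \<alpha> \<C>)"
    unfolding X_def by (rule seminorm_on_C1a_boundary_norm[OF \<alpha>(1) atlas])
  have semi_Y: "seminorm_on Y (C1a_norm \<alpha> T)"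
    unfolding Y_def by (rule seminorm_on_C1a_norm[OF T(2,1) T_ne \<alpha>(1)])
  have semi_Z: "seminorm_on Z (C1a_norm \<alpha> \<Omega>o)"
    unfolding Z_def by (rule seminorm_on_C1a_norm[OF Omega_o(2) open_o o_ne \<alpha>(1)])
  have E_an: "real_analytic_map X (C1a_boundary_norm \<alpha> \<C>) Y (C1a_norm \<alpha> T) X E"
    using E_analytic by (simp add: X_def Y_def T_def)
  then have EY: "E \<phi> \<in> Y" if "\<phi> \<in> X" for \<phi>
    using that by (auto simp: real_analytic_map_def)
  have BX: "boundary_diffeos_in \<alpha> \<Omega>o \<Omega>i \<subseteq> X"
    by (auto simp: boundary_diffeos_in_def boundary_diffeos_def X_def)
  then have WX: "\<W>t \<subseteq> X"
    using W_tilde(1) by (auto simp: relatively_open_def)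
  have linL: "linear L"
    by (rule linearI)
      (auto simp: L_def fun_eq_iff plus_fun_def scaleR_fun_def algebra_simps)
  have L_bound: "L h \<in> Z \<and> C1a_norm \<alpha> \<Omega>o (L h) \<le> 3 * C * C1a_norm \<alpha> T h" if "h \<in> Y" for h
  proof -
    have "C1a_on \<alpha> T h" using that by (simp add: Y_def C1a_space_def)
    from C[OF this] obtain g' where der: "\<And>x. (L h has_derivative g' x) (at x)"
      and b: "\<And>x. norm (L h x) \<le> C * C1a_norm \<alpha> T h"
        "\<And>x v. norm (g' x v) \<le> C * C1a_norm \<alpha> T h * norm v"
        "\<And>x y v. norm (g' x v - g' y v) \<le> C * C1a_norm \<alpha> T h * dist x y powr \<alpha> * norm v"
      by auto
    have pos: "0 \<le> C * C1a_norm \<alpha> T h"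
      using C0 seminorm_on_nonneg[OF semi_Y that] by simp
    have "continuous_on (closure \<Omega>o) (L h)"
      by (intro continuous_at_imp_continuous_on ballI has_derivative_continuous[OF der])
    then have "C1a_on \<alpha> \<Omega>o (L h)"
      by (rule C1a_onI[OF _ der has_derivative_bounded_linear[OF der] b(3)])
    moreover have "L h x = 0" if "x \<notin> closure \<Omega>o" for x
      using that L_off K K_o closure_subset by blast
    moreover have "C1a_norm \<alpha> \<Omega>o (L h) \<le>
        C * C1a_norm \<alpha> T h + C * C1a_norm \<alpha> T h + C * C1a_norm \<alpha> T h"
      by (rule C1a_norm_leI[OF open_o o_ne der b(1,2) pos b(3) pos])
    ultimately show ?thesis by (simp add: Z_def C1a_space_def)
  qed
  \<comment> \<open>\<open>\<Psi>\<close> is written as an affine map applied to \<open>E\<close>; \<open>c\<close> collects the part of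
    \<open>id + \<eta> (E \<phi> - E \<phi>0)\<close> that does not depend on \<open>\<phi>\<close>.\<close>
  define c where "c = restrict_zero (closure \<Omega>o) id - L (E \<phi>0)"
  have cZ: "c \<in> Z"
  proof -
    have "C1a_on \<alpha> \<Omega>o (\<lambda>x :: real ^ 'n. x)"
      by (rule C1a_onI[where f' = "\<lambda>_ v. v" and C = 0]) (auto intro: continuous_intros)
    then have "C1a_on \<alpha> \<Omega>o (restrict_zero (closure \<Omega>o) id :: real ^ 'n \<Rightarrow> real ^ 'n)"
      by (rule C1a_on_cong[OF open_o]) (simp add: restrict_zero_def)
    then have "restrict_zero (closure \<Omega>o) id \<in> Z"
      by (simp add: Z_def C1a_space_def restrict_zero_def)
    then show ?thesis
      unfolding c_def using L_bound[of "E \<phi>0"] EY WX W_tilde(2)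
      by (intro subspace_diff seminorm_on_subspace[OF semi_Z]) auto
  qed
  define \<Psi> where "\<Psi> = (\<lambda>\<phi>. c + L (E \<phi>))"
  have \<Psi>_eq: "\<Psi> \<phi> x = x + L (E \<phi> - E \<phi>0) x" if "x \<in> closure \<Omega>o" for \<phi> x
    using that by (simp add: \<Psi>_def c_def plus_fun_def fun_diff_def L_def restrict_zero_def
        scaleR_diff_right)
  \<comment> \<open>\<open>C * \<epsilon> \<le> 1/2\<close> makes the perturbation of the identity a contraction.\<close>
  define \<epsilon> where "\<epsilon> = 1 / (2 * (C + 1))"
  have \<epsilon>: "0 < \<epsilon>" "C * \<epsilon> \<le> 1 / 2"
    using C0 by (auto simp: \<epsilon>_def field_simps)
  define W where "W = {\<phi> \<in> \<W>t. C1a_norm \<alpha> T (E \<phi> - E \<phi>0) < \<epsilon>}"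
  have W_Wt: "W \<subseteq> \<W>t" by (auto simp: W_def)
  have W_open: "relatively_open (C1a_boundary_norm \<alpha> \<C>) (boundary_diffeos_in \<alpha> \<Omega>o \<Omega>i) W"
    unfolding W_def using EY WX W_tilde(2)
    by (intro relatively_open_preimage_ball[OF semi_X semi_Y E_an W_tilde(1) BX]) auto
  have \<phi>0_W: "\<phi>0 \<in> W"
    using W_tilde(2) \<epsilon>(1) seminorm_on_0[OF semi_Y] by (simp add: W_def)
  have an: "real_analytic_map X (C1a_boundary_norm \<alpha> \<C>) Z (C1a_norm \<alpha> \<Omega>o) W \<Psi>"
    unfolding \<Psi>_def
    by (rule real_analytic_map_affine_comp[OF semi_Y semi_Z seminorm_on_subspace[OF semi_X] E_an
          _ linL _ _ _ cZ, of _ "3 * C"])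
      (use L_bound W_Wt WX C0 in auto)

  have diffeo: "C1a_diffeo \<alpha> \<Omega>o \<Omega>o (\<Psi> \<phi>)"
      and image_i: "\<Psi> \<phi> ` \<Omega>i = enclosed_domain \<Omega>i \<phi>"
      and image_o: "\<Psi> \<phi> ` (\<Omega>o - closure \<Omega>i) = \<Omega>o - closure (enclosed_domain \<Omega>i \<phi>)"
      and \<Psi>_A: "x \<in> A \<Longrightarrow> \<Psi> \<phi> x = E \<phi> x"
    if \<phi>: "\<phi> \<in> W" for \<phi> x
  proof -
    define h where "h = E \<phi> - E \<phi>0"
    have "h \<in> Y"
      unfolding h_def using \<phi> W_Wt WX W_tilde(2)
      by (intro subspace_diff seminorm_on_subspace[OF semi_Y] EY) auto
    then have "C1a_on \<alpha> T h" by (simp add: Y_def C1a_space_def)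
    from C[OF this] obtain g' where der: "\<And>x. (L h has_derivative g' x) (at x)"
      and b: "\<And>x v. norm (g' x v) \<le> C * C1a_norm \<alpha> T h * norm v"
        "\<And>x y v. norm (g' x v - g' y v) \<le> C * C1a_norm \<alpha> T h * dist x y powr \<alpha> * norm v"
      by auto
    have "C1a_norm \<alpha> T h \<le> \<epsilon>"
      using \<phi> by (simp add: W_def h_def)
    then have "C * C1a_norm \<alpha> T h \<le> 1 / 2"
      using mult_left_mono[of _ \<epsilon> C] C0 \<epsilon>(2) by fastforce
    then have half: "norm (g' x v) \<le> 1 / 2 * norm v" for x v
      by (rule order.trans[OF b(1) mult_right_mono[OF _ norm_ge_zero]])
    have off: "L h x = 0" if "x \<notin> K" for x
      using that K(3) L_off by blast
    \<comment> \<open>\<open>F\<close> is a map of the whole space, whereas \<open>\<Psi> \<phi>\<close> is \<open>0\<close> off the closure of \<open>\<Omega>o\<close>.\<close>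
    define F where "F = (\<lambda>x. x + L h x)"
    have \<Psi>F: "\<Psi> \<phi> x = F x" if "x \<in> closure \<Omega>o" for x
      using \<Psi>_eq[OF that] by (simp add: F_def h_def)
    have \<Psi>_id_plus: "\<Psi> \<phi> x = x + L h x" if "x \<in> closure \<Omega>o" for x
      using \<Psi>_eq[OF that] by (simp add: h_def)
    note plus = C1a_diffeo_id_plus[where f = "\<Psi> \<phi>",
        OF der half b(2) \<alpha>(1) off K_o open_o \<Psi>_id_plus, folded F_def]
    show "C1a_diffeo \<alpha> \<Omega>o \<Omega>o (\<Psi> \<phi>)" by (rule plus(1))
    show \<Psi>_A: "\<Psi> \<phi> x = E \<phi> x" if "x \<in> A" for x
    proof -
      have "x \<in> closure T" "x \<in> closure \<Omega>o"
        using that A(2) K(2,3) T_o closure_subset by blast+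
      then show ?thesis
        using \<Psi>_eq[of x \<phi>] \<eta>1 that E\<phi>0[of x] by (simp add: L_def fun_diff_def)
    qed
    have fr: "frontier \<Omega>i \<subseteq> A"
      unfolding A_def using tube_\<rho>1(4) closure_subset by blast
    have "F ` frontier \<Omega>i = \<phi> ` frontier \<Omega>i"
    proof (rule image_cong[OF refl])
      fix x assume x: "x \<in> frontier \<Omega>i"
      then have "x \<in> A" using fr by blast
      moreover have "x \<in> closure \<Omega>o"
        using \<open>x \<in> A\<close> A(2) K(2,3) T_o closure_subset by blast
      ultimately show "F x = \<phi> x"
        using \<Psi>_A[of x] \<Psi>F[of x] E_extends[OF _ x, of \<phi>] \<phi> W_Wt by auto
    qed
    then have encl: "enclosed_domain \<Omega>i \<phi> = F ` \<Omega>i"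
      using inside_homeomorphic_image_frontier(1)[OF plus(2) open_i Omega_i(2-4)]
      by (simp add: enclosed_domain_def)
    have cl_encl: "closure (F ` \<Omega>i) = F ` closure \<Omega>i"
      by (rule inside_homeomorphic_image_frontier(2)[OF plus(2) open_i Omega_i(2-4)])
    have sub: "\<Omega>i \<subseteq> closure \<Omega>o" "\<Omega>o - closure \<Omega>i \<subseteq> closure \<Omega>o"
      using inclusion closure_subset by blast+
    have "\<Psi> \<phi> ` \<Omega>i = F ` \<Omega>i"
      using sub(1) \<Psi>F by (intro image_cong) auto
    then show "\<Psi> \<phi> ` \<Omega>i = enclosed_domain \<Omega>i \<phi>" by (simp add: encl)
    have "inj F"
      using plus(2) by (metis homeomorphism_def UNIV_I injI)
    have "\<Psi> \<phi> ` (\<Omega>o - closure \<Omega>i) = F ` (\<Omega>o - closure \<Omega>i)"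
      using sub(2) \<Psi>F by (intro image_cong) auto
    also have "\<dots> = F ` \<Omega>o - F ` closure \<Omega>i"
      by (rule image_set_diff[OF \<open>inj F\<close>])
    finally show "\<Psi> \<phi> ` (\<Omega>o - closure \<Omega>i) = \<Omega>o - closure (enclosed_domain \<Omega>i \<phi>)"
      by (simp add: encl cl_encl plus(3))
  qed
  have \<Psi>_off: "\<Psi> \<phi> x = x" if "x \<in> closure \<Omega>o - tube \<Omega>i \<omega> \<rho>2" for \<phi> x
    using that \<Psi>_eq[of x \<phi>] L_off by (simp add: V_def)
  show ?thesis
    using W_open \<phi>0_W W_Wt \<rho> delta_tilde(2) an[unfolded X_def Z_def] diffeo image_i image_o
      \<Psi>_A[unfolded A_def] \<Psi>_off
    by (intro exI[of _ W] exI[of _ \<rho>1] exI[of _ \<rho>2] exI[of _ \<Psi>] conjI ballI) auto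
qed

end
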